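(* Let $E\to\mathsf G$ be a left-invariant exact Courant algebroid over a Lie group $\mathsf G$, with infinitesimal data $(\mathfrak G=\mathfrak g\oplus\mathfrak g^*,\langle\cdot,\cdot\rangle,\boldsymbol\mu=\mu_{H})$. The generalized Ricci curvature of any invariant generalized metric $\mathcal G$ satisfies $$\mathcal Rc(\mathcal G)=\Big(\tfrac23\,\mathrm{Ric}_{\mathcal G}-\tfrac16B_{\mathcal G}-\mathrm{Sym}_{\mathcal G}(\mathrm{ad}^{\boldsymbol\mu}_U)\Big)_{\mathfrak{so}},$$ where $U=g^{-1}\mathrm{tr}\,\mathrm{ad}_{(\cdot)}\in\mathfrak g$ is the mean curvature vector of the metric Lie algebra $(\mathfrak g,\mu,g)$ and $g$ is the inner product on $\mathfrak g$ induced by $\mathcal G$. Moreover, the generalized scalar curvature $\mathcal S$ of $\mathcal G$ satisfies $$\mathcal S(\mathcal G)=\tfrac12\,\mathrm{tr}\Big(\tfrac23\,\mathrm{Ric}_{\mathcal G}-\tfrac16B_{\mathcal G}\Big)-|U|^2 .$$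
   Context: $(\mathfrak g,\mu)$ is the Lie algebra of $\mathsf G$, $H\in\Lambda^3\mathfrak g^*$ is closed, $\langle X+\xi,Y+\eta\rangle=\tfrac12(\xi(Y)+\eta(X))$, and $$\mu_H(X+\xi,Y+\eta)=\mu(X,Y)-\eta\circ\mathrm{ad}_\mu(X)+\xi\circ\mathrm{ad}_\mu(Y)+\iota_Y\iota_XH$$ is the $H$-twisted Dorfman bracket, a Lie bracket on $\mathfrak G$; $\mathrm{ad}^{\boldsymbol\mu}_x=\boldsymbol\mu(x,\cdot)$. An invariant generalized metric is $\mathcal G\in\mathsf{SO}(\mathfrak G,\langle\cdot,\cdot\rangle)$ with $\mathcal G^2=\mathrm{Id}$ and $\langle\mathcal G\cdot,\cdot\rangle$ positive definite; it is identified with the inner product $2\langle\mathcal G\cdot,\cdot\rangle$ on $\mathfrak G$. Each is uniquely $\mathcal G=e^b\begin{pmatrix}0&g^{-1}\\ g&0\end{pmatrix}e^{-b}$, $e^b(X+\xi)=X+\xi+\iota_Xb$, with $g$ an inner product on $\mathfrak g$ and $b\in\Lambda^2\mathfrak g^*$; its torsion is $H_{\mathcal G}=H+db$. The preferred isotropic splitting of $\mathcal G$ is $X\mapsto X+\iota_Xb$, by which $U\in\mathfrak g$ is regarded as an element of $\mathfrak G$ in $\mathrm{ad}^{\boldsymbol\mu}_U$. Norms: $g$ is extended to tensors so that tensor products of orthonormal basis vectors are orthonormal; thus $|H|^2=\sum_{i,j,k}H_{ijk}^2$ and $H^2(X,Y)=g(\iota_XH,\iota_YH)$. $d_g^*$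 is the codifferential of the left-invariant metric $g$. The generalized Ricci curvature and scalar curvature are $$\mathcal Rc(\mathcal G)=e^b\begin{pmatrix}R&\tfrac12g^{-1}(d_g^*H_{\mathcal G})g^{-1}\\-\tfrac12d_g^*H_{\mathcal G}&-R^*\end{pmatrix}e^{-b},\quad R=g^{-1}(\mathrm{Ric}_g-\tfrac14H_{\mathcal G}^2),\qquad \mathcal S(\mathcal G)=\mathrm{scal}(g)-\tfrac1{12}|H_{\mathcal G}|^2 .$$ $\mathrm{Ric}_{\mathcal G}\in\mathrm{End}(\mathfrak G)$ is the (classical Riemannian) Ricci operator of the left-invariant metric $2\langle\mathcal G\cdot,\cdot\rangle$ on the simply-connected Lie group with Lie algebra $(\mathfrak G,\boldsymbol\mu)$. $B_{\mathcal G}$ is defined by $2\langle\mathcal GB_{\mathcal G}\cdot,\cdot\rangle=\kappa_{\boldsymbol\mu}$, the Killing form of $(\mathfrak G,\boldsymbol\mu)$. $\mathrm{Sym}_{\mathcal G}(\cdot)$ is the symmetric part with respect to $2\langle\mathcal G\cdot,\cdot\rangle$, and $\mathrm{Sym}(\mathfrak G,\mathcal G)$ the space of symmetric endomorphisms. $(\cdot)_{\mathfrak{so}}$ is the orthogonal projection, for the inner product $\mathrm{tr}(AB)$, from $\mathrm{Sym}(\mathfrak G,\mathcal G)$ onto $\mathfrak{so}(\mathfrak G,\langle\cdot,\cdot\rangle)\cap\mathrm{Sym}(\mathfrak G,\mathcal G)$. *)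

theory Defs
  imports "HOL-Analysis.Analysis"
begin

text \<open>
  The Lie algebra is carried by an arbitrary finite-dimensional real vector space
  \<open>'a :: euclidean_space\<close>; the inner product that this class provides is never used. Its dual
  is the type of (automatically bounded) linear functionals, so that \<open>'a double\<close> is literally the
  direct sum of the vector space and its dual. Left-invariant objects on a Lie group are given by
  their values on left-invariant vector fields, i.e. on the Lie algebra.
\<close>

type_synonym 'a dual = "'a \<Rightarrow>\<^sub>L real"
type_synonym 'a double = "'a \<times> 'a dual"


subsection \<open>Linear algebra on a finite-dimensional real vector space\<close>

text \<open>The sum of the diagonal coefficients in some basis of the whole space.\<close>

definition endo_trace :: "('v::real_vector \<Rightarrow> 'v) \<Rightarrow> real" where
  "endo_trace f =
     (\<Sum>v\<in>extend_basis {}. representation (extend_basis {}) (f v) v)"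

definition is_inner_product :: "('v::real_vector \<Rightarrow> 'v \<Rightarrow> real) \<Rightarrow> bool" where
  "is_inner_product q \<longleftrightarrow>
     bilinear q \<and> (\<forall>x y. q x y = q y x) \<and> (\<forall>x. x \<noteq> 0 \<longrightarrow> q x x > 0)"

definition orthonormal_basis :: "('v::real_vector \<Rightarrow> 'v \<Rightarrow> real) \<Rightarrow> 'v set" where
  "orthonormal_basis q =
     (SOME B. span B = UNIV \<and> (\<forall>x\<in>B. \<forall>y\<in>B. q x y = (if x = y then 1 else 0)))"

text \<open>The endomorphism \<open>A\<close> with \<open>q (A x) y = \<beta> x y\<close>.\<close>

definition operator_of ::
  "('v::real_vector \<Rightarrow> 'v \<Rightarrow> real) \<Rightarrow> ('v \<Rightarrow> 'v \<Rightarrow> real) \<Rightarrow> 'v \<Rightarrow> 'v" where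
  "operator_of q \<beta> x = (THE z. \<forall>y. q z y = \<beta> x y)"

definition adjoint_wrt ::
  "('v::real_vector \<Rightarrow> 'v \<Rightarrow> real) \<Rightarrow> ('v \<Rightarrow> 'v) \<Rightarrow> 'v \<Rightarrow> 'v" where
  "adjoint_wrt q A = (THE A'. \<forall>x y. q (A x) y = q x (A' y))"

definition sym_part ::
  "('v::real_vector \<Rightarrow> 'v \<Rightarrow> real) \<Rightarrow> ('v \<Rightarrow> 'v) \<Rightarrow> 'v \<Rightarrow> 'v" where
  "sym_part q A x = (1/2) *\<^sub>R (A x + adjoint_wrt q A x)"

definition sym_endos ::
  "('v::real_vector \<Rightarrow> 'v \<Rightarrow> real) \<Rightarrow> ('v \<Rightarrow> 'v) set" where
  "sym_endos q = {A. linear A \<and> (\<forall>x y. q (A x) y = q x (A y))}"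

definition skew_endos ::
  "('v::real_vector \<Rightarrow> 'v \<Rightarrow> real) \<Rightarrow> ('v \<Rightarrow> 'v) set" where
  "skew_endos p = {A. linear A \<and> (\<forall>x y. p (A x) y + p x (A y) = 0)}"

text \<open>
  \<open>flat \<beta>\<close> is the map \<open>X \<mapsto> \<iota>\<^sub>X \<beta> = \<beta>(X, \<cdot>)\<close> into the dual; \<open>sharp g\<close> is
  the inverse of \<open>flat g\<close> for an inner product \<open>g\<close>.
\<close>

definition flat :: "('a::euclidean_space \<Rightarrow> 'a \<Rightarrow> real) \<Rightarrow> 'a \<Rightarrow> 'a dual" where
  "flat \<beta> X = Blinfun (\<beta> X)"

definition sharp :: "('a::euclidean_space \<Rightarrow> 'a \<Rightarrow> real) \<Rightarrow> 'a dual \<Rightarrow> 'a" where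
  "sharp g \<xi> = (THE X. \<forall>Y. g X Y = blinfun_apply \<xi> Y)"


subsection \<open>Lie brackets, the Killing form and curvature of left-invariant metrics\<close>

definition lie_bracket :: "('v::real_vector \<Rightarrow> 'v \<Rightarrow> 'v) \<Rightarrow> bool" where
  "lie_bracket \<mu> \<longleftrightarrow> bilinear \<mu> \<and> (\<forall>x. \<mu> x x = 0) \<and>
     (\<forall>x y z. \<mu> x (\<mu> y z) + \<mu> y (\<mu> z x) + \<mu> z (\<mu> x y) = 0)"

definition killing_form :: "('v::real_vector \<Rightarrow> 'v \<Rightarrow> 'v) \<Rightarrow> 'v \<Rightarrow> 'v \<Rightarrow> real" where
  "killing_form \<mu> x y = endo_trace (\<mu> x \<circ> \<mu> y)"

text \<open>
  The Levi-Civita connection of the left-invariant metric \<open>q\<close>, restricted to left-invariant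
  vector fields (on which \<open>q\<close> is constant): the torsion-free connection preserving the metric.
\<close>

definition levi_civita ::
  "('v::real_vector \<Rightarrow> 'v \<Rightarrow> 'v) \<Rightarrow> ('v \<Rightarrow> 'v \<Rightarrow> real) \<Rightarrow> 'v \<Rightarrow> 'v \<Rightarrow> 'v" where
  "levi_civita \<mu> q = (THE D. bilinear D \<and> (\<forall>x y. D x y - D y x = \<mu> x y) \<and>
     (\<forall>x y z. q (D x y) z + q y (D x z) = 0))"

definition curvature ::
  "('v::real_vector \<Rightarrow> 'v \<Rightarrow> 'v) \<Rightarrow> ('v \<Rightarrow> 'v \<Rightarrow> real) \<Rightarrow> 'v \<Rightarrow> 'v \<Rightarrow> 'v \<Rightarrow> 'v" where
  "curvature \<mu> q x y z =
     (let D = levi_civita \<mu> q in D x (D y z) - D y (D x z) - D (\<mu> x y) z)"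

definition ricci_tensor ::
  "('v::real_vector \<Rightarrow> 'v \<Rightarrow> 'v) \<Rightarrow> ('v \<Rightarrow> 'v \<Rightarrow> real) \<Rightarrow> 'v \<Rightarrow> 'v \<Rightarrow> real" where
  "ricci_tensor \<mu> q y z = endo_trace (\<lambda>x. curvature \<mu> q x y z)"

definition ricci_operator ::
  "('v::real_vector \<Rightarrow> 'v \<Rightarrow> 'v) \<Rightarrow> ('v \<Rightarrow> 'v \<Rightarrow> real) \<Rightarrow> 'v \<Rightarrow> 'v" where
  "ricci_operator \<mu> q = operator_of q (ricci_tensor \<mu> q)"

definition scalar_curvature ::
  "('v::real_vector \<Rightarrow> 'v \<Rightarrow> 'v) \<Rightarrow> ('v \<Rightarrow> 'v \<Rightarrow> real) \<Rightarrow> real" where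
  "scalar_curvature \<mu> q = endo_trace (ricci_operator \<mu> q)"

definition mean_curvature_vector ::
  "('a::euclidean_space \<Rightarrow> 'a \<Rightarrow> 'a) \<Rightarrow> ('a \<Rightarrow> 'a \<Rightarrow> real) \<Rightarrow> 'a" where
  "mean_curvature_vector \<mu> g = sharp g (Blinfun (\<lambda>X. endo_trace (\<mu> X)))"


subsection \<open>Left-invariant forms\<close>

definition two_form :: "('v::real_vector \<Rightarrow> 'v \<Rightarrow> real) \<Rightarrow> bool" where
  "two_form b \<longleftrightarrow> bilinear b \<and> (\<forall>x. b x x = 0)"

definition three_form :: "('v::real_vector \<Rightarrow> 'v \<Rightarrow> 'v \<Rightarrow> real) \<Rightarrow> bool" where
  "three_form H \<longleftrightarrow>
     (\<forall>y z. linear (\<lambda>x. H x y z)) \<and> (\<forall>x z. linear (\<lambda>y. H x y z)) \<and>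
     (\<forall>x y. linear (\<lambda>z. H x y z)) \<and>
     (\<forall>x y. H x x y = 0 \<and> H x y x = 0 \<and> H y x x = 0)"

text \<open>
  The exterior derivative of left-invariant forms,
  \<open>d\<omega>(x\<^sub>0, \<dots>, x\<^sub>k) = \<Sum>(-1)\<^sup>i\<^sup>+\<^sup>j \<omega>([x\<^sub>i, x\<^sub>j], \<dots>)\<close> summed over \<open>i < j\<close>, in degrees two and three.
\<close>

definition d2 ::
  "('v::real_vector \<Rightarrow> 'v \<Rightarrow> 'v) \<Rightarrow> ('v \<Rightarrow> 'v \<Rightarrow> real) \<Rightarrow> 'v \<Rightarrow> 'v \<Rightarrow> 'v \<Rightarrow> real" where
  "d2 \<mu> b x y z = - b (\<mu> x y) z + b (\<mu> x z) y - b (\<mu> y z) x"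

definition d3 ::
  "('v::real_vector \<Rightarrow> 'v \<Rightarrow> 'v) \<Rightarrow> ('v \<Rightarrow> 'v \<Rightarrow> 'v \<Rightarrow> real) \<Rightarrow> 'v \<Rightarrow> 'v \<Rightarrow> 'v \<Rightarrow> 'v \<Rightarrow> real"
  where
  "d3 \<mu> H x y z w =
     - H (\<mu> x y) z w + H (\<mu> x z) y w - H (\<mu> x w) y z
     - H (\<mu> y z) x w + H (\<mu> y w) x z - H (\<mu> z w) x y"

definition nabla3 ::
  "('v::real_vector \<Rightarrow> 'v \<Rightarrow> 'v) \<Rightarrow> ('v \<Rightarrow> 'v \<Rightarrow> real) \<Rightarrow> 'v \<Rightarrow> ('v \<Rightarrow> 'v \<Rightarrow> 'v \<Rightarrow> real)
     \<Rightarrow> 'v \<Rightarrow> 'v \<Rightarrow> 'v \<Rightarrow> real" where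
  "nabla3 \<mu> g w H x y z =
     (let D = levi_civita \<mu> g in - H (D w x) y z - H x (D w y) z - H x y (D w z))"

text \<open>
  The Riemannian codifferential (formal adjoint of \<open>d\<close> on the group) of a three-form,
  \<open>d\<^sup>*H = - \<Sum>\<^sub>i \<iota>\<^bsub>e\<^sub>i\<^esub> \<nabla>\<^bsub>e\<^sub>i\<^esub> H\<close>. For non-unimodular brackets it differs from the algebraic
  adjoint of \<open>d2\<close>.
\<close>

definition codiff3 ::
  "('v::real_vector \<Rightarrow> 'v \<Rightarrow> 'v) \<Rightarrow> ('v \<Rightarrow> 'v \<Rightarrow> real) \<Rightarrow> ('v \<Rightarrow> 'v \<Rightarrow> 'v \<Rightarrow> real)
     \<Rightarrow> 'v \<Rightarrow> 'v \<Rightarrow> real" where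
  "codiff3 \<mu> g H y z = - (\<Sum>e\<in>orthonormal_basis g. nabla3 \<mu> g e H e y z)"

text \<open>Tensor norms, without factorials.\<close>

definition tensor2_inner ::
  "('v::real_vector \<Rightarrow> 'v \<Rightarrow> real) \<Rightarrow> ('v \<Rightarrow> 'v \<Rightarrow> real) \<Rightarrow> ('v \<Rightarrow> 'v \<Rightarrow> real) \<Rightarrow> real" where
  "tensor2_inner g \<alpha> \<beta> =
     (\<Sum>e\<in>orthonormal_basis g. \<Sum>f\<in>orthonormal_basis g. \<alpha> e f * \<beta> e f)"

definition tensor3_norm_sq ::
  "('v::real_vector \<Rightarrow> 'v \<Rightarrow> real) \<Rightarrow> ('v \<Rightarrow> 'v \<Rightarrow> 'v \<Rightarrow> real) \<Rightarrow> real" where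
  "tensor3_norm_sq g H =
     (\<Sum>e\<in>orthonormal_basis g. \<Sum>f\<in>orthonormal_basis g. \<Sum>h\<in>orthonormal_basis g. (H e f h)\<^sup>2)"

definition form_square ::
  "('v::real_vector \<Rightarrow> 'v \<Rightarrow> real) \<Rightarrow> ('v \<Rightarrow> 'v \<Rightarrow> 'v \<Rightarrow> real) \<Rightarrow> 'v \<Rightarrow> 'v \<Rightarrow> real" where
  "form_square g H x y = tensor2_inner g (H x) (H y)"


subsection \<open>The double and generalized metrics\<close>

fun pairing :: "'a::euclidean_space double \<Rightarrow> 'a double \<Rightarrow> real" where
  "pairing (X, \<xi>) (Y, \<eta>) = (1/2) * (blinfun_apply \<xi> Y + blinfun_apply \<eta> X)"

fun dorfman ::
  "('a::euclidean_space \<Rightarrow> 'a \<Rightarrow> 'a) \<Rightarrow> ('a \<Rightarrow> 'a \<Rightarrow> 'a \<Rightarrow> real)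
     \<Rightarrow> 'a double \<Rightarrow> 'a double \<Rightarrow> 'a double" where
  "dorfman \<mu> H (X, \<xi>) (Y, \<eta>) =
     (\<mu> X Y,
      Blinfun (\<lambda>Z. - blinfun_apply \<eta> (\<mu> X Z) + blinfun_apply \<xi> (\<mu> Y Z) + H X Y Z))"

text \<open>
  An orthogonal \<open>\<G>\<close> with these properties has determinant \<open>(-1)\<^sup>n\<close>, where \<open>n\<close> is the dimension
  of \<open>'a\<close>. Hence \<open>\<G>\<close> is only required to preserve the pairing; asking for determinant one
  would exclude every odd \<open>n\<close>.
\<close>

definition generalized_metric :: "('a::euclidean_space double \<Rightarrow> 'a double) \<Rightarrow> bool" where
  "generalized_metric \<G> \<longleftrightarrow> linear \<G> \<and>
     (\<forall>x y. pairing (\<G> x) (\<G> y) = pairing x y) \<and>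
     \<G> \<circ> \<G> = id \<and>
     (\<forall>x. x \<noteq> 0 \<longrightarrow> pairing (\<G> x) x > 0)"

definition gm_inner ::
  "('a::euclidean_space double \<Rightarrow> 'a double) \<Rightarrow> 'a double \<Rightarrow> 'a double \<Rightarrow> real" where
  "gm_inner \<G> x y = 2 * pairing (\<G> x) y"

fun b_transform :: "('a::euclidean_space \<Rightarrow> 'a \<Rightarrow> real) \<Rightarrow> 'a double \<Rightarrow> 'a double" where
  "b_transform b (X, \<xi>) = (X, \<xi> + flat b X)"

fun block ::
  "('a::euclidean_space \<Rightarrow> 'a) \<Rightarrow> ('a dual \<Rightarrow> 'a) \<Rightarrow> ('a \<Rightarrow> 'a dual) \<Rightarrow> ('a dual \<Rightarrow> 'a dual)
     \<Rightarrow> 'a double \<Rightarrow> 'a double" where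
  "block A B C D (X, \<xi>) = (A X + B \<xi>, C X + D \<xi>)"

definition b_conjugate ::
  "('a::euclidean_space \<Rightarrow> 'a \<Rightarrow> real) \<Rightarrow> ('a double \<Rightarrow> 'a double) \<Rightarrow> 'a double \<Rightarrow> 'a double" where
  "b_conjugate b A = b_transform b \<circ> A \<circ> b_transform (\<lambda>X Y. - b X Y)"

definition gm_decomposition ::
  "('a::euclidean_space double \<Rightarrow> 'a double) \<Rightarrow> ('a \<Rightarrow> 'a \<Rightarrow> real) \<Rightarrow> ('a \<Rightarrow> 'a \<Rightarrow> real) \<Rightarrow> bool"
  where
  "gm_decomposition \<G> g b \<longleftrightarrow> is_inner_product g \<and> two_form b \<and>
     \<G> = b_conjugate b (block (\<lambda>_. 0) (sharp g) (flat g) (\<lambda>_. 0))"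

definition gm_metric ::
  "('a::euclidean_space double \<Rightarrow> 'a double) \<Rightarrow> 'a \<Rightarrow> 'a \<Rightarrow> real" where
  "gm_metric \<G> = (THE g. \<exists>b. gm_decomposition \<G> g b)"

definition gm_two_form ::
  "('a::euclidean_space double \<Rightarrow> 'a double) \<Rightarrow> 'a \<Rightarrow> 'a \<Rightarrow> real" where
  "gm_two_form \<G> = (THE b. \<exists>g. gm_decomposition \<G> g b)"

definition gm_torsion ::
  "('a::euclidean_space \<Rightarrow> 'a \<Rightarrow> 'a) \<Rightarrow> ('a \<Rightarrow> 'a \<Rightarrow> 'a \<Rightarrow> real)
     \<Rightarrow> ('a double \<Rightarrow> 'a double) \<Rightarrow> 'a \<Rightarrow> 'a \<Rightarrow> 'a \<Rightarrow> real" where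
  "gm_torsion \<mu> H \<G> X Y Z = H X Y Z + d2 \<mu> (gm_two_form \<G>) X Y Z"

text \<open>The preferred isotropic splitting.\<close>

definition gm_splitting ::
  "('a::euclidean_space double \<Rightarrow> 'a double) \<Rightarrow> 'a \<Rightarrow> 'a double" where
  "gm_splitting \<G> X = (X, flat (gm_two_form \<G>) X)"


subsection \<open>Generalized curvature\<close>

definition gen_ricci ::
  "('a::euclidean_space \<Rightarrow> 'a \<Rightarrow> 'a) \<Rightarrow> ('a \<Rightarrow> 'a \<Rightarrow> 'a \<Rightarrow> real)
     \<Rightarrow> ('a double \<Rightarrow> 'a double) \<Rightarrow> 'a double \<Rightarrow> 'a double" where
  "gen_ricci \<mu> H \<G> =
     (let g = gm_metric \<G>;
          HG = gm_torsion \<mu> H \<G>;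
          R = operator_of g (\<lambda>X Y. ricci_tensor \<mu> g X Y - (1/4) * form_square g HG X Y);
          \<delta> = flat (codiff3 \<mu> g HG)
      in b_conjugate (gm_two_form \<G>)
           (block R (\<lambda>\<xi>. (1/2) *\<^sub>R sharp g (\<delta> (sharp g \<xi>)))
              (\<lambda>X. - (1/2) *\<^sub>R \<delta> X) (\<lambda>\<xi>. - Blinfun (\<lambda>X. blinfun_apply \<xi> (R X)))))"

definition gen_scalar ::
  "('a::euclidean_space \<Rightarrow> 'a \<Rightarrow> 'a) \<Rightarrow> ('a \<Rightarrow> 'a \<Rightarrow> 'a \<Rightarrow> real)
     \<Rightarrow> ('a double \<Rightarrow> 'a double) \<Rightarrow> real" where
  "gen_scalar \<mu> H \<G> =
     scalar_curvature \<mu> (gm_metric \<G>)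
       - (1/12) * tensor3_norm_sq (gm_metric \<G>) (gm_torsion \<mu> H \<G>)"

definition killing_operator ::
  "('a::euclidean_space \<Rightarrow> 'a \<Rightarrow> 'a) \<Rightarrow> ('a \<Rightarrow> 'a \<Rightarrow> 'a \<Rightarrow> real)
     \<Rightarrow> ('a double \<Rightarrow> 'a double) \<Rightarrow> 'a double \<Rightarrow> 'a double" where
  "killing_operator \<mu> H \<G> = operator_of (gm_inner \<G>) (killing_form (dorfman \<mu> H))"

text \<open>
  The orthogonal projection, with respect to \<open>(A, B) \<mapsto> tr (A B)\<close>, onto the symmetric
  endomorphisms that are skew for the pairing.
\<close>

definition so_projection ::
  "('a::euclidean_space double \<Rightarrow> 'a double) \<Rightarrow> ('a double \<Rightarrow> 'a double)
     \<Rightarrow> 'a double \<Rightarrow> 'a double" where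
  "so_projection \<G> A =
     (THE P. P \<in> skew_endos pairing \<inter> sym_endos (gm_inner \<G>) \<and>
        (\<forall>C \<in> skew_endos pairing \<inter> sym_endos (gm_inner \<G>).
           endo_trace ((\<lambda>x. A x - P x) \<circ> C) = 0))"

end

theory Submission
  imports Defs
begin

text \<open>
  A generalized metric \<open>\<G>\<close> decomposes into an inner product \<open>g\<close> and a two-form \<open>b\<close>. It makes
  the double an orthogonal sum of two copies of the Euclidean space \<open>(\<gg>, g)\<close>, namely the graph
  of \<open>b\<close> and the dual, and it exchanges the two. A \<open>g\<close>-orthonormal frame of \<open>\<gg>\<close> thus gives an
  orthonormal frame of the double in which the structure constants of the Dorfman bracket are
  those of \<open>\<mu>\<close> together with the components of the torsion \<open>H + db\<close>
  (\<open>structure_constants\<close>).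

  The Ricci tensor of a left-invariant metric is, in an orthonormal frame, a quadratic expression
  in the structure constants, minus half the Killing form, minus a term coming from the mean
  curvature vector (\<open>ricci_tensor_frame\<close>). On the double the last term is absent, because
  \<open>ad\<close> is skew for the pairing and therefore traceless. What remains of
  \<open>2/3 Ric - 1/6 B\<close> is \<open>2/3\<close> of the quadratic part minus half the Killing form. All its blocks can
  be written down in terms of \<open>\<mu>\<close> and the torsion (\<open>double_ricci_blocks\<close>,
  \<open>double_killing\<close>).

  The symmetric endomorphisms that are skew for the pairing are those that anticommute with
  \<open>\<G>\<close>, so that the projection onto them is \<open>A \<mapsto> (A - \<G>A\<G>)/2\<close> (\<open>so_projection_eq\<close>). It takes the
  difference of the two diagonal blocks and the difference of the two off-diagonal ones. With
  \<open>ad\<^sub>U\<close> supplying the missing mean curvature terms, the first is the Ricci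
  tensor of \<open>g\<close> minus a quarter of the square of the torsion, and the second is the codifferential
  of the torsion (\<open>curv_blocks\<close>). The scalar identity is the trace of the same block formulas.
\<close>

section \<open>Orthonormal frames\<close>

text \<open>
  The curvature computations are all made in orthonormal frames, on the Lie algebra as well as on
  its double. The double is only a real vector space, so the frame is also what supplies
  finite-dimensionality.
\<close>

locale orthonormal_frame =
  fixes q :: "'v::real_vector \<Rightarrow> 'v \<Rightarrow> real" and B :: "'v set"
  assumes inner: "is_inner_product q"
    and finite_frame: "finite B"
    and span_frame: "span B = UNIV"
    and orthonormal: "\<And>e f. e \<in> B \<Longrightarrow> f \<in> B \<Longrightarrow> q e f = (if e = f then 1 else 0)"
begin

lemma bilinear_q: "bilinear q"
  using inner by (simp add: is_inner_product_def)

lemmas q_simps =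
  bilinear_ladd[OF bilinear_q] bilinear_radd[OF bilinear_q]
  bilinear_lmul[OF bilinear_q] bilinear_rmul[OF bilinear_q]
  bilinear_lneg[OF bilinear_q] bilinear_rneg[OF bilinear_q]
  bilinear_lsub[OF bilinear_q] bilinear_rsub[OF bilinear_q]
  bilinear_lzero[OF bilinear_q] bilinear_rzero[OF bilinear_q]

lemma linear_q_left: "linear (\<lambda>x. q x y)" and linear_q_right: "linear (q x)"
  using bilinear_q by (simp_all add: bilinear_def)

lemma q_sum_left: "q (\<Sum>i\<in>I. F i) y = (\<Sum>i\<in>I. q (F i) y)"
  by (rule linear_sum[OF linear_q_left])

lemma q_commute: "q x y = q y x"
  using inner by (simp add: is_inner_product_def)

lemma q_positive: "x \<noteq> 0 \<Longrightarrow> q x x > 0"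
  using inner by (simp add: is_inner_product_def)

lemma q_eqI: "x = y" if "\<And>z. q x z = q y z"
proof -
  have "q (x - y) (x - y) = 0"
    using that by (simp add: q_simps)
  then have "x - y = 0"
    using q_positive by (metis less_irrefl)
  then show ?thesis by simp
qed

lemma frame_expansion: "(\<Sum>e\<in>B. q x e *\<^sub>R e) = x"
proof -
  have "x \<in> span B" by (simp add: span_frame)
  then show ?thesis
  proof (induction rule: span_induct_alt)
    case base
    then show ?case by (simp add: q_simps)
  next
    case (step c f y)
    have "(\<Sum>e\<in>B. q (c *\<^sub>R f + y) e *\<^sub>R e)
        = c *\<^sub>R (\<Sum>e\<in>B. q f e *\<^sub>R e) + (\<Sum>e\<in>B. q y e *\<^sub>R e)"
      by (simp add: q_simps scaleR_sum_right scaleR_add_left sum.distrib)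
    also have "(\<Sum>e\<in>B. q f e *\<^sub>R e) = (\<Sum>e\<in>B. if e = f then e else 0)"
      using step(1) by (intro sum.cong) (auto simp: orthonormal)
    also have "\<dots> = f"
      using step(1) finite_frame by simp
    finally show ?case using step(2) by simp
  qed
qed

lemma linear_frame_expansion:
  assumes "linear L"
  shows "(\<Sum>e\<in>B. q x e *\<^sub>R L e) = L x"
proof -
  have "L x = L (\<Sum>e\<in>B. q x e *\<^sub>R e)" by (simp add: frame_expansion)
  also have "\<dots> = (\<Sum>e\<in>B. q x e *\<^sub>R L e)"
    using assms by (simp add: linear_sum linear_scale)
  finally show ?thesis by simp
qed

lemma functional_frame_expansion:
  fixes L :: "'v \<Rightarrow> real"
  assumes "linear L"
  shows "(\<Sum>e\<in>B. q x e * L e) = L x"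
  using linear_frame_expansion[OF assms] by simp

lemma parseval: "(\<Sum>e\<in>B. q x e * q y e) = q x y"
  using functional_frame_expansion[OF linear_q_right[of y], of x] q_commute by metis

text \<open>
  The basis behind \<open>endo_trace\<close> is unspecified; expanding each of its elements in the frame
  makes the sum over it collapse.
\<close>

lemma endo_trace_frame:
  assumes "linear f"
  shows "endo_trace f = (\<Sum>e\<in>B. q (f e) e)"
proof -
  define C :: "'v set" where "C = extend_basis {}"
  have indep: "independent C" and spC: "span C = UNIV"
    using independent_extend_basis[OF independent_empty] span_extend_basis[OF independent_empty]
    by (simp_all add: C_def)
  have fin: "finite C"
    using independent_span_bound[OF finite_frame indep] by (simp add: span_frame)
  have "representation C (f v) v = (\<Sum>e\<in>B. q v e * representation C (f e) v)" for v
  proof -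
    have "f v = (\<Sum>e\<in>B. q v e *\<^sub>R f e)"
      using linear_frame_expansion[OF assms] by simp
    then show ?thesis
      by (simp add: representation_sum[OF indep] representation_scale[OF indep] spC)
  qed
  then have "endo_trace f = (\<Sum>v\<in>C. \<Sum>e\<in>B. q v e * representation C (f e) v)"
    by (simp add: endo_trace_def flip: C_def)
  also have "\<dots> = (\<Sum>e\<in>B. \<Sum>v\<in>C. q v e * representation C (f e) v)"
    by (rule sum.swap)
  also have "\<dots> = (\<Sum>e\<in>B. q (\<Sum>v\<in>C. representation C (f e) v *\<^sub>R v) e)"
    by (simp add: q_sum_left q_simps mult.commute)
  also have "\<dots> = (\<Sum>e\<in>B. q (f e) e)"
    using sum_representation_eq[OF indep _ fin subset_refl] by (simp add: spC)
  finally show ?thesis .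
qed

lemma endo_trace_compose:
  assumes "linear f" "linear h"
  shows "endo_trace (\<lambda>x. f (h x)) = (\<Sum>a\<in>B. \<Sum>b\<in>B. q (f b) a * q (h a) b)"
proof -
  have "linear (\<lambda>x. f (h x))"
    using linear_compose[OF assms(2,1)] by (simp add: o_def)
  moreover have "q (f (h a)) a = (\<Sum>b\<in>B. q (h a) b * q (f b) a)" for a
    using functional_frame_expansion[OF linear_compose[OF assms(1) linear_q_left[of a]], of "h a"]
    by simp
  ultimately show ?thesis
    by (simp add: endo_trace_frame mult.commute)
qed

lemma endo_trace_compose_commute:
  fixes f h :: "'v \<Rightarrow> 'v"
  assumes "linear f" "linear h"
  shows "endo_trace (\<lambda>x. f (h x)) = endo_trace (\<lambda>x. h (f x))"
  unfolding endo_trace_compose[OF assms] endo_trace_compose[OF assms(2,1)]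
  by (subst sum.swap) (simp add: mult.commute)

lemma q_riesz:
  assumes "linear L"
  shows "q (\<Sum>e\<in>B. L e *\<^sub>R e) y = L y"
proof -
  have "q (\<Sum>e\<in>B. L e *\<^sub>R e) y = (\<Sum>e\<in>B. L e * q e y)"
    by (simp add: q_sum_left q_simps)
  also have "\<dots> = (\<Sum>e\<in>B. q y e * L e)"
    by (simp add: q_commute[of y] mult.commute)
  finally show ?thesis using functional_frame_expansion[OF assms] by simp
qed

lemma operator_of_works:
  assumes "bilinear \<beta>"
  shows "q (operator_of q \<beta> x) y = \<beta> x y"
proof -
  have L: "linear (\<beta> x)" using assms by (simp add: bilinear_def)
  have "\<forall>y. q (operator_of q \<beta> x) y = \<beta> x y"
    unfolding operator_of_def
    by (rule theI[of _ "\<Sum>e\<in>B. \<beta> x e *\<^sub>R e"])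
      (auto intro: q_eqI simp: q_riesz[OF L])
  then show ?thesis by simp
qed

lemma linear_operator_of:
  assumes "bilinear \<beta>"
  shows "linear (operator_of q \<beta>)"
  by (rule linearI; rule q_eqI)
    (simp_all add: operator_of_works[OF assms] q_simps bilinear_ladd[OF assms]
      bilinear_lmul[OF assms])

lemma adjoint_wrt_works:
  assumes "linear A"
  shows "q (adjoint_wrt q A x) y = q x (A y)"
proof -
  have "\<forall>x y. q (A x) y = q x (adjoint_wrt q A y)"
    unfolding adjoint_wrt_def
  proof (rule theI[of _ "\<lambda>y. \<Sum>e\<in>B. q (A e) y *\<^sub>R e"])
    have lin: "linear (\<lambda>e. q (A e) y)" for y
      using linear_compose[OF assms linear_q_left] by (simp add: o_def)
    show "\<forall>x y. q (A x) y = q x (\<Sum>e\<in>B. q (A e) y *\<^sub>R e)"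
      using q_riesz[OF lin] q_commute by metis
    then show "A' = (\<lambda>y. \<Sum>e\<in>B. q (A e) y *\<^sub>R e)"
      if "\<forall>x y. q (A x) y = q x (A' y)" for A'
      using that by (intro ext q_eqI) (metis q_commute)
  qed
  then show ?thesis using q_commute by metis
qed

lemma sym_part_works:
  assumes "linear A"
  shows "q (sym_part q A x) y = (1/2) * (q (A x) y + q x (A y))"
  by (simp add: sym_part_def q_simps adjoint_wrt_works[OF assms])

lemma linear_sym_part:
  assumes "linear A"
  shows "linear (sym_part q A)"
  by (rule linearI; rule q_eqI)
    (simp_all add: sym_part_works[OF assms] linear_add[OF assms] linear_scale[OF assms] q_simps
      algebra_simps)

end

text \<open>
  Gram--Schmidt, one vector at a time, for an inner product unrelated to the one of the type class.
\<close>

lemma gram_schmidt: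
  assumes q: "is_inner_product q" and "finite S"
  shows "\<exists>B. finite B \<and> span B = span S \<and>
    (\<forall>x\<in>B. \<forall>y\<in>B. q x y = (if x = y then 1 else 0))"
  using \<open>finite S\<close>
proof (induction rule: finite_induct)
  case empty
  then show ?case by (intro exI[of _ "{}"]) simp
next
  case (insert x S)
  then obtain B where fin: "finite B" and sp: "span B = span S"
    and on: "\<forall>x\<in>B. \<forall>y\<in>B. q x y = (if x = y then 1 else 0)"
    by blast
  have bil: "bilinear q" and sym: "\<And>x y. q x y = q y x"
    and pos: "\<And>x. x \<noteq> 0 \<Longrightarrow> q x x > 0"
    using q by (auto simp: is_inner_product_def)
  define p where "p = (\<Sum>e\<in>B. q x e *\<^sub>R e)"
  define y where "y = x - p"
  have p: "p \<in> span B"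
    unfolding p_def by (intro span_sum span_scale span_base)
  have orth: "q y f = 0" if "f \<in> B" for f
  proof -
    have lin: "linear (\<lambda>x. q x f)" using bil by (simp add: bilinear_def)
    have "q p f = (\<Sum>e\<in>B. q x e * q e f)"
      unfolding p_def by (simp add: linear_sum[OF lin] bilinear_lmul[OF bil])
    also have "\<dots> = (\<Sum>e\<in>B. if e = f then q x e else 0)"
      using on that by (intro sum.cong) auto
    also have "\<dots> = q x f" using fin that by simp
    finally show ?thesis by (simp add: y_def bilinear_lsub[OF bil])
  qed
  show ?case
  proof (cases "y = 0")
    case True
    then have "x \<in> span S" using p sp by (simp add: y_def)
    then have "span (insert x S) = span S" by (rule span_redundant)
    then show ?thesis using fin sp on by auto
  next
    case False
    define z where "z = (1 / sqrt (q y y)) *\<^sub>R y"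
    have zz: "q z z = 1"
      using pos[OF False]
      by (simp add: z_def bilinear_lmul[OF bil] bilinear_rmul[OF bil] field_simps)
    have zf: "q z f = 0" if "f \<in> B" for f
      using orth[OF that] by (simp add: z_def bilinear_lmul[OF bil])
    have x_eq: "x = sqrt (q y y) *\<^sub>R z + p"
      using pos[OF False] by (simp add: z_def y_def)
    have "x \<in> span (insert z B)"
      using p unfolding x_eq
      by (intro span_add span_scale) (auto intro: span_base span_mono[THEN subsetD])
    moreover have "z \<in> span (insert x B)"
      using p unfolding z_def y_def
      by (intro span_scale span_diff) (auto intro: span_base span_mono[THEN subsetD])
    ultimately have "span (insert z B) = span (insert x B)"
      by (subst span_eq) (auto intro: span_base)
    also have "\<dots> = span (insert x S)"
      using sp by (simp add: span_insert)
    finally have "span (insert z B) = span (insert x S)" .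
    moreover have "\<forall>a\<in>insert z B. \<forall>b\<in>insert z B. q a b = (if a = b then 1 else 0)"
      using on zz zf sym by (metis insert_iff)
    ultimately show ?thesis
      using fin by (intro exI[of _ "insert z B"]) auto
  qed
qed

lemma orthonormal_basis_frame:
  fixes g :: "'a::euclidean_space \<Rightarrow> 'a \<Rightarrow> real"
  assumes "is_inner_product g"
  shows "orthonormal_frame g (orthonormal_basis g)"
proof -
  let ?P = "\<lambda>B. span B = UNIV \<and> (\<forall>x\<in>B. \<forall>y\<in>B. g x y = (if x = y then 1 else 0))"
  have bil: "bilinear g" using assms by (simp add: is_inner_product_def)
  have "\<exists>B. ?P B"
    using gram_schmidt[OF assms finite_Basis] by auto
  then have P: "?P (orthonormal_basis g)"
    unfolding orthonormal_basis_def by (rule someI_ex)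
  have "independent (orthonormal_basis g)"
    unfolding independent_explicit_finite_subsets
  proof (intro allI impI ballI)
    fix S u v
    assume S: "S \<subseteq> orthonormal_basis g" "finite S" "(\<Sum>w\<in>S. u w *\<^sub>R w) = 0" and v: "v \<in> S"
    have lin: "linear (\<lambda>w. g w v)" using bil by (simp add: bilinear_def)
    have "0 = g (\<Sum>w\<in>S. u w *\<^sub>R w) v"
      using S(3) by (simp add: bilinear_lzero[OF bil])
    also have "\<dots> = (\<Sum>w\<in>S. u w * g w v)"
      by (simp add: linear_sum[OF lin] bilinear_lmul[OF bil])
    also have "\<dots> = (\<Sum>w\<in>S. if w = v then u w else 0)"
      using P S(1) v by (intro sum.cong) (auto simp: subset_iff)
    also have "\<dots> = u v" using S(2) v by simp
    finally show "u v = 0" by simp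
  qed
  then have "finite (orthonormal_basis g)"
    by (rule independent_imp_finite)
  with P show ?thesis
    by unfold_locales (auto simp: assms)
qed

section \<open>Curvature of a metric algebra\<close>

lemma alternating_skew:
  fixes f :: "'v::real_vector \<Rightarrow> 'v \<Rightarrow> 'w::real_vector"
  assumes bil: "bilinear f" and self: "\<And>x. f x x = 0"
  shows "f x y = - f y x"
proof -
  have "f (x + y) (x + y) = 0" by (rule self)
  then have "f x x + f y x + (f x y + f y y) = 0"
    by (simp only: bilinear_ladd[OF bil] bilinear_radd[OF bil] add_ac)
  then have "f x y + f y x = 0" by (simp add: self add.commute)
  then show ?thesis by (rule eq_neg_iff_add_eq_0[THEN iffD2])
qed

lemma three_form_skew:
  assumes "three_form h"
  shows "h x y z = - h y x z" "h x y z = - h x z y"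
proof -
  show "h x y z = - h y x z"
    by (rule alternating_skew[of "\<lambda>x y. h x y z"])
      (use assms in \<open>simp_all add: three_form_def bilinear_def\<close>)
  show "h x y z = - h x z y"
    by (rule alternating_skew[of "h x"])
      (use assms in \<open>simp_all add: three_form_def bilinear_def\<close>)
qed

text \<open>
  Both the Lie algebra and its double are instances. The trace of \<open>ad [y, z]\<close>, which up to a
  factor is the skew part of the Ricci tensor, vanishes on the former by the Jacobi identity and
  on the latter by invariance of the pairing.
\<close>

locale metric_algebra = orthonormal_frame q B
  for q :: "'v::real_vector \<Rightarrow> 'v \<Rightarrow> real" and B :: "'v set" +
  fixes \<mu> :: "'v \<Rightarrow> 'v \<Rightarrow> 'v"
  assumes bilinear_bracket: "bilinear \<mu>"
    and bracket_self: "\<mu> x x = 0"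
begin

lemmas bracket_simps =
  bilinear_ladd[OF bilinear_bracket] bilinear_radd[OF bilinear_bracket]
  bilinear_lmul[OF bilinear_bracket] bilinear_rmul[OF bilinear_bracket]
  bilinear_lneg[OF bilinear_bracket] bilinear_rneg[OF bilinear_bracket]
  bilinear_lsub[OF bilinear_bracket] bilinear_rsub[OF bilinear_bracket]
  bilinear_lzero[OF bilinear_bracket] bilinear_rzero[OF bilinear_bracket]

lemma linear_bracket_right: "linear (\<mu> x)"
  using bilinear_bracket by (simp_all add: bilinear_def)

lemma bracket_skew: "\<mu> x y = - \<mu> y x"
  by (rule alternating_skew[OF bilinear_bracket bracket_self])

lemma killing_form_frame:
  "killing_form \<mu> y z = (\<Sum>a\<in>B. \<Sum>b\<in>B. q (\<mu> y b) a * q (\<mu> z a) b)"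
  using endo_trace_compose[OF linear_bracket_right linear_bracket_right, of y z]
  by (simp add: killing_form_def o_def)

lemma bilinear_killing_form: "bilinear (killing_form \<mu>)"
  unfolding bilinear_def
  by (intro conjI allI linearI)
    (simp_all add: killing_form_frame bracket_simps q_simps algebra_simps
      sum.distrib sum_distrib_left)

lemma linear_trace_ad: "linear (\<lambda>x. endo_trace (\<mu> x))"
  by (rule linearI)
    (simp_all add: endo_trace_frame linear_bracket_right bracket_simps q_simps sum.distrib
      sum_distrib_left)

lemma killing_form_commute: "killing_form \<mu> y z = killing_form \<mu> z y"
  unfolding killing_form_frame by (subst sum.swap) (simp add: mult.commute)

text \<open>The right-hand side of the Koszul formula.\<close>

definition koszul :: "'v \<Rightarrow> 'v \<Rightarrow> 'v \<Rightarrow> real" where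
  "koszul x y z = (1/2) * (q (\<mu> x y) z - q (\<mu> y z) x + q (\<mu> z x) y)"

lemma
  shows levi_civita_bilinear: "bilinear (levi_civita \<mu> q)"
    and levi_civita_koszul: "q (levi_civita \<mu> q x y) z = koszul x y z"
proof -
  let ?P = "\<lambda>D. bilinear D \<and> (\<forall>x y. D x y - D y x = \<mu> x y) \<and>
     (\<forall>x y z. q (D x y) z + q y (D x z) = 0)"
  define D where "D x y = (\<Sum>e\<in>B. koszul x y e *\<^sub>R e)" for x y
  have D: "q (D x y) z = koszul x y z" for x y z
  proof -
    have "linear (koszul x y)"
      by (rule linearI) (simp_all add: koszul_def bracket_simps q_simps algebra_simps)
    then show ?thesis unfolding D_def by (rule q_riesz)
  qed
  have "bilinear D"
    unfolding bilinear_def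
    by (intro conjI allI linearI; rule q_eqI)
      (simp_all add: D q_simps koszul_def bracket_simps algebra_simps)
  moreover have "D x y - D y x = \<mu> x y" for x y
  proof (rule q_eqI)
    show "q (D x y - D y x) z = q (\<mu> x y) z" for z
      by (simp add: D q_simps koszul_def bracket_skew[of y x] bracket_skew[of z y]
          bracket_skew[of z x] field_simps)
  qed
  moreover have "q (D x y) z + q y (D x z) = 0" for x y z
    by (simp add: D q_commute[of y] koszul_def bracket_skew[of z x] bracket_skew[of z y]
        bracket_skew[of y x] q_simps field_simps)
  ultimately have PD: "?P D" by blast
  have uniq: "q (D' x y) z = koszul x y z" if P: "?P D'" for D' x y z
  proof -
    have tor: "q (\<mu> a b) c = q (D' a b) c - q (D' b a) c" for a b c
      using P q_simps by metis
    have met: "q (D' a b) c = - q (D' a c) b" for a b c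
      using P q_commute by (metis add_eq_0_iff2)
    show ?thesis
      unfolding koszul_def tor using met[of x z y] met[of y z x] met[of z y x] met[of y x z] met[of z x y]
      by (simp add: field_simps)
  qed
  have "levi_civita \<mu> q = D"
    unfolding levi_civita_def
  proof (rule the_equality)
    show "D' = D" if "?P D'" for D'
      using uniq[OF that] D by (intro ext q_eqI) metis
  qed (rule PD)
  then show "bilinear (levi_civita \<mu> q)" "q (levi_civita \<mu> q x y) z = koszul x y z"
    using PD D by auto
qed

lemma koszul_skew: "koszul x y z = - koszul x z y"
  by (simp add: koszul_def bracket_skew[of z x] bracket_skew[of z y]
        bracket_skew[of y x] q_simps field_simps)

lemma koszul_torsion: "koszul e y f - koszul f y e = - q (\<mu> e f) y"
  by (simp add: koszul_def bracket_skew[of f e] bracket_skew[of f y]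
        bracket_skew[of y e] q_simps field_simps)

lemma sum_symmetrize:
  fixes F G :: "'v \<Rightarrow> 'v \<Rightarrow> real"
  assumes "\<And>e f. F e f + F f e = G e f + G f e"
  shows "(\<Sum>e\<in>B. \<Sum>f\<in>B. F e f) = (\<Sum>e\<in>B. \<Sum>f\<in>B. G e f)"
proof -
  have "2 * (\<Sum>e\<in>B. \<Sum>f\<in>B. F e f) = (\<Sum>e\<in>B. \<Sum>f\<in>B. F e f + F f e)" for F :: "'v \<Rightarrow> 'v \<Rightarrow> real"
    using sum.swap[of F B B] by (simp add: sum.distrib)
  from this[of F] this[of G] show ?thesis using assms by simp
qed

context
  fixes u :: 'v
  assumes u: "\<And>x. q u x = endo_trace (\<mu> x)"
begin

text \<open>
  By the Koszul formula, the component of \<open>\<nabla>\<^bsub>e\<^esub> e\<close> along \<open>x\<close> is that of \<open>[x, e]\<close> along \<open>e\<close>. This is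
  how the trace of \<open>ad\<close> enters both the Ricci tensor and the codifferential.
\<close>

lemma mean_curvature_frame: "(\<Sum>e\<in>B. levi_civita \<mu> q e e) = u"
proof (rule q_eqI)
  fix x
  have "q (\<Sum>e\<in>B. levi_civita \<mu> q e e) x = (\<Sum>e\<in>B. koszul e e x)"
    by (simp add: q_sum_left levi_civita_koszul)
  also have "\<dots> = (\<Sum>e\<in>B. q (\<mu> x e) e)"
    by (simp add: koszul_def bracket_self bracket_skew[of _ x] q_simps)
  also have "\<dots> = q u x"
    by (simp add: u endo_trace_frame linear_bracket_right)
  finally show "q (\<Sum>e\<in>B. levi_civita \<mu> q e e) x = q u x" .
qed

text \<open>
  Metric compatibility moves every derivative onto frame vectors, which turns the trace of the
  curvature into a double sum of products of Koszul terms. After symmetrization in the two frame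
  indices the torsion identity applies and the mixed products of structure constants cancel.
\<close>

lemma ricci_tensor_frame:
  "ricci_tensor \<mu> q y z =
     (1/4) * (\<Sum>e\<in>B. \<Sum>f\<in>B. q (\<mu> e f) y * q (\<mu> e f) z)
     - (1/2) * (\<Sum>e\<in>B. \<Sum>f\<in>B. q (\<mu> y e) f * q (\<mu> z e) f)
     - (1/2) * killing_form \<mu> y z
     - (1/2) * (endo_trace (\<mu> (\<mu> y z)) + q (\<mu> u y) z + q (\<mu> u z) y)"
proof -
  let ?D = "levi_civita \<mu> q"
  note bil = levi_civita_bilinear
  note D_simps = bilinear_ladd[OF bil] bilinear_radd[OF bil] bilinear_lmul[OF bil]
    bilinear_rmul[OF bil]
  have lin: "linear (\<lambda>x. curvature \<mu> q x y z)"
    unfolding curvature_def Let_def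
    by (rule linearI) (simp_all add: D_simps bracket_simps algebra_simps)
  have skew: "q (?D x v) w = - q v (?D x w)" for x v w
    by (simp add: levi_civita_koszul q_commute[of v] koszul_skew[of x v])
  have first: "(\<Sum>e\<in>B. q (?D e (?D y z)) e) = - q u (?D y z)"
  proof -
    have "(\<Sum>e\<in>B. q (?D e (?D y z)) e) = - (\<Sum>e\<in>B. q (?D e e) (?D y z))"
      by (simp add: skew[of _ "?D y z"] sum_negf q_commute[of "?D y z"])
    then show ?thesis by (simp flip: q_sum_left add: mean_curvature_frame)
  qed
  have second: "q (?D y (?D e z)) e = - (\<Sum>f\<in>B. koszul e z f * koszul y e f)" for e
  proof -
    have "q (?D y (?D e z)) e = - q (?D e z) (?D y e)" by (rule skew)
    also have "q (?D e z) (?D y e) = (\<Sum>f\<in>B. q (?D e z) f * q (?D y e) f)"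
      by (simp add: parseval)
    finally show ?thesis by (simp add: levi_civita_koszul)
  qed
  have third: "q (?D (\<mu> e y) z) e = (\<Sum>f\<in>B. q (\<mu> e y) f * koszul f z e)" for e
  proof -
    have "linear (\<lambda>x. koszul x z e)"
      by (rule linearI) (simp_all add: koszul_def bracket_simps q_simps algebra_simps)
    from functional_frame_expansion[OF this] show ?thesis by (simp add: levi_civita_koszul)
  qed
  have "ricci_tensor \<mu> q y z = (\<Sum>e\<in>B. q (curvature \<mu> q e y z) e)"
    by (simp add: ricci_tensor_def endo_trace_frame[OF lin])
  also have "\<dots> = - q u (?D y z)
      + (\<Sum>e\<in>B. \<Sum>f\<in>B. koszul e z f * koszul y e f - q (\<mu> e y) f * koszul f z e)"
    by (simp add: curvature_def Let_def q_simps second third sum.distrib sum_subtractf sum_negf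
        flip: first)
  also have "(\<Sum>e\<in>B. \<Sum>f\<in>B. koszul e z f * koszul y e f - q (\<mu> e y) f * koszul f z e)
    = (\<Sum>e\<in>B. \<Sum>f\<in>B. (1/4) * (q (\<mu> e f) y * q (\<mu> e f) z)
        - (1/2) * (q (\<mu> y e) f * q (\<mu> z e) f) - (1/2) * (q (\<mu> y f) e * q (\<mu> z e) f))"
  proof (rule sum_symmetrize)
    fix e f
    note skews = bracket_skew[of f e] bracket_skew[of f y] bracket_skew[of e y]
      bracket_skew[of f z] bracket_skew[of e z]
    show "koszul e z f * koszul y e f - q (\<mu> e y) f * koszul f z e +
      (koszul f z e * koszul y f e - q (\<mu> f y) e * koszul e z f) =
      (1/4) * (q (\<mu> e f) y * q (\<mu> e f) z)
        - (1/2) * (q (\<mu> y e) f * q (\<mu> z e) f) - (1/2) * (q (\<mu> y f) e * q (\<mu> z e) f) +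
      ((1/4) * (q (\<mu> f e) y * q (\<mu> f e) z)
        - (1/2) * (q (\<mu> y f) e * q (\<mu> z f) e) - (1/2) * (q (\<mu> y e) f * q (\<mu> z f) e))"
      unfolding koszul_def skews by (simp add: q_simps field_simps)
  qed
  also have "q u (?D y z) = koszul y z u"
    by (simp add: q_commute[of u] levi_civita_koszul)
  also have "\<dots> = (1/2) * (endo_trace (\<mu> (\<mu> y z)) + q (\<mu> u y) z + q (\<mu> u z) y)"
    by (simp add: koszul_def bracket_skew[of z u] q_simps flip: u q_commute[of u])
  finally show ?thesis
    by (simp add: killing_form_frame sum_subtractf sum_divide_distrib)
qed

lemma bilinear_ricci_tensor: "bilinear (ricci_tensor \<mu> q)"
  unfolding bilinear_def
  by (intro conjI allI linearI)
    (simp_all add: ricci_tensor_frame bracket_simps q_simps linear_add[OF linear_trace_ad]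
      linear_scale[OF linear_trace_ad] bilinear_ladd[OF bilinear_killing_form]
      bilinear_radd[OF bilinear_killing_form] bilinear_lmul[OF bilinear_killing_form]
      bilinear_rmul[OF bilinear_killing_form] algebra_simps add_divide_distrib
      sum.distrib sum_distrib_left)

lemma ricci_tensor_commute:
  assumes "\<And>x y. endo_trace (\<mu> (\<mu> x y)) = 0"
  shows "ricci_tensor \<mu> q y z = ricci_tensor \<mu> q z y"
  by (simp add: ricci_tensor_frame assms killing_form_commute[of y z] mult.commute add.commute)

text \<open>
  Besides the trace of the connection, the codifferential pairs \<open>\<nabla>\<^bsub>e\<^esub> y\<close> with the slot of \<open>h\<close> next to
  \<open>e\<close>. As \<open>h\<close> is alternating, only the skew part in these two frame indices survives, and by
  torsion-freeness that part is the bracket.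
\<close>

lemma codiff3_frame:
  assumes h: "three_form h" and B: "B = orthonormal_basis q"
  shows "codiff3 \<mu> q h y z = h u y z
     - (1/2) * (\<Sum>e\<in>B. \<Sum>f\<in>B. q (\<mu> e f) y * h e f z)
     + (1/2) * (\<Sum>e\<in>B. \<Sum>f\<in>B. q (\<mu> e f) z * h e f y)"
proof -
  let ?D = "levi_civita \<mu> q"
  have lin1: "linear (\<lambda>x. h x a b)" and lin2: "linear (\<lambda>x. h a x b)" for a b
    using h by (simp_all add: three_form_def)
  note skew12 = three_form_skew(1)[OF h] and skew23 = three_form_skew(2)[OF h]
  have contract: "(\<Sum>e\<in>B. h e (?D e v) w) = - (1/2) * (\<Sum>e\<in>B. \<Sum>f\<in>B. q (\<mu> e f) v * h e f w)"
    for v w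
  proof -
    have "(\<Sum>e\<in>B. h e (?D e v) w) = (\<Sum>e\<in>B. \<Sum>f\<in>B. koszul e v f * h e f w)"
      using functional_frame_expansion[OF lin2] by (simp flip: levi_civita_koszul)
    also have "\<dots> = (\<Sum>e\<in>B. \<Sum>f\<in>B. - (1/2) * (q (\<mu> e f) v * h e f w))"
    proof (rule sum_symmetrize)
      fix e f
      have "koszul e v f * h e f w + koszul f v e * h f e w = (koszul e v f - koszul f v e) * h e f w"
        by (simp add: skew12[of f e] algebra_simps)
      then show "koszul e v f * h e f w + koszul f v e * h f e w =
         - (1/2) * (q (\<mu> e f) v * h e f w) + - (1/2) * (q (\<mu> f e) v * h f e w)"
        by (simp add: koszul_torsion skew12[of f e] bracket_skew[of f e] q_simps)
    qed
    finally show ?thesis by (simp add: sum_distrib_left sum_negf)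
  qed
  have "codiff3 \<mu> q h y z
      = (\<Sum>e\<in>B. h (?D e e) y z) + (\<Sum>e\<in>B. h e (?D e y) z) - (\<Sum>e\<in>B. h e (?D e z) y)"
    by (simp add: codiff3_def nabla3_def Let_def sum.distrib sum_negf sum_subtractf
        skew23[of _ y] flip: B)
  also have "(\<Sum>e\<in>B. h (?D e e) y z) = h u y z"
    by (simp flip: linear_sum[OF lin1] add: mean_curvature_frame)
  finally show ?thesis by (simp add: contract)
qed

end

lemma endo_trace_ad_bracket:
  assumes "lie_bracket \<mu>"
  shows "endo_trace (\<mu> (\<mu> x y)) = 0"
proof -
  have jac: "\<mu> x (\<mu> y z) + \<mu> y (\<mu> z x) + \<mu> z (\<mu> x y) = 0" for z
    using assms by (simp add: lie_bracket_def)
  have comm: "\<mu> (\<mu> x y) z = \<mu> x (\<mu> y z) - \<mu> y (\<mu> x z)" for z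
    using jac[of z] bracket_skew[of z "\<mu> x y"] bracket_skew[of z x]
    by (simp add: bracket_simps algebra_simps)
  have lin: "linear (\<lambda>z. \<mu> a (\<mu> b z))" for a b
    using linear_compose[OF linear_bracket_right linear_bracket_right] by (simp add: o_def)
  have "endo_trace (\<mu> (\<mu> x y)) = endo_trace (\<lambda>z. \<mu> x (\<mu> y z)) - endo_trace (\<lambda>z. \<mu> y (\<mu> x z))"
    by (simp add: endo_trace_frame linear_bracket_right lin comm q_simps sum_subtractf)
  then show ?thesis
    using endo_trace_compose_commute[OF linear_bracket_right linear_bracket_right, of x y] by simp
qed

end

section \<open>Generalized metrics\<close>

lemma blinfun_apply_Blinfun_linear:
  fixes f :: "'a::euclidean_space \<Rightarrow> real"
  assumes "linear f"
  shows "blinfun_apply (Blinfun f) = f"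
  using assms by (simp add: bounded_linear_Blinfun_apply linear_conv_bounded_linear)

lemma flat_apply: "blinfun_apply (flat \<beta> X) Y = \<beta> X Y" if "bilinear \<beta>"
  using that by (simp add: flat_def blinfun_apply_Blinfun_linear bilinear_def)

lemma linear_flat: "linear (flat \<beta>)" if "bilinear \<beta>"
  by (rule linearI; rule blinfun_eqI)
    (simp_all add: flat_apply[OF that] blinfun.bilinear_simps bilinear_ladd[OF that]
      bilinear_lmul[OF that])

lemma linear_blinfun_apply: "linear (blinfun_apply \<xi>)"
  by (rule linearI) (simp_all add: blinfun.bilinear_simps)

lemma inner_product_bilinear: "is_inner_product g \<Longrightarrow> bilinear g"
  by (simp add: is_inner_product_def)

lemma sharp_works:
  fixes g :: "'a::euclidean_space \<Rightarrow> 'a \<Rightarrow> real"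
  assumes "is_inner_product g"
  shows "g (sharp g \<xi>) Y = blinfun_apply \<xi> Y"
proof -
  interpret orthonormal_frame g "orthonormal_basis g"
    by (rule orthonormal_basis_frame[OF assms])
  have "\<forall>Y. g (sharp g \<xi>) Y = blinfun_apply \<xi> Y"
    unfolding sharp_def
    by (rule theI[of _ "\<Sum>e\<in>orthonormal_basis g. blinfun_apply \<xi> e *\<^sub>R e"])
      (auto intro: q_eqI simp: q_riesz[OF linear_blinfun_apply])
  then show ?thesis by simp
qed

lemma flat_sharp: "is_inner_product g \<Longrightarrow> flat g (sharp g \<xi>) = \<xi>"
  by (rule blinfun_eqI) (simp add: flat_apply inner_product_bilinear sharp_works)

lemma sharp_flat:
  fixes g :: "'a::euclidean_space \<Rightarrow> 'a \<Rightarrow> real"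
  assumes "is_inner_product g"
  shows "sharp g (flat g X) = X"
proof -
  interpret orthonormal_frame g "orthonormal_basis g"
    by (rule orthonormal_basis_frame[OF assms])
  show ?thesis
    by (rule q_eqI) (simp add: sharp_works[OF assms] flat_apply bilinear_q)
qed

lemma is_inner_product_inner: "is_inner_product (inner :: 'a::euclidean_space \<Rightarrow> _)"
  by (auto simp: is_inner_product_def bilinear_def inner_commute
      intro!: linearI simp: inner_add_left inner_add_right)

lemma two_form_skew: "two_form b \<Longrightarrow> b x y = - b y x"
  by (rule alternating_skew) (simp_all add: two_form_def)

lemma flat_uminus: "flat (\<lambda>X Y. - b X Y) X = - flat b X" if "bilinear b"
proof -
  have "bilinear (\<lambda>X Y. - b X Y)"
    using that by (auto simp: bilinear_def linear_iff)
  then show ?thesis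
    by (intro blinfun_eqI) (simp add: flat_apply that blinfun.bilinear_simps)
qed

text \<open>
  The form in which the decomposition is used: the graph of \<open>b\<close> and the dual span the double, and
  the values of \<open>\<G>\<close> on them involve neither \<open>sharp\<close> nor conjugation by \<open>e\<^sup>b\<close>.
\<close>

lemma gm_decomposition_iff:
  fixes \<G> :: "'a::euclidean_space double \<Rightarrow> 'a double"
  assumes "linear \<G>"
  shows "gm_decomposition \<G> g b \<longleftrightarrow> is_inner_product g \<and> two_form b \<and>
    (\<forall>X. \<G> (X, flat b X) = (0, flat g X)) \<and> (\<forall>X. \<G> (0, flat g X) = (X, flat b X))"
    (is "_ \<longleftrightarrow> _ \<and> _ \<and> ?swap")
proof -
  have "\<G> = b_conjugate b (block (\<lambda>_. 0) (sharp g) (flat g) (\<lambda>_. 0)) \<longleftrightarrow> ?swap"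
    if g: "is_inner_product g" and b: "two_form b"
  proof -
    have bilb: "bilinear b" using b by (simp add: two_form_def)
    have b0: "flat b 0 = 0"
      using linear_0[OF linear_flat[OF bilb]] .
    have val: "b_conjugate b (block (\<lambda>_. 0) (sharp g) (flat g) (\<lambda>_. 0)) (X, \<xi>)
        = (let Y = sharp g (\<xi> - flat b X) in (Y, flat g X + flat b Y))" for X \<xi>
      by (simp add: b_conjugate_def flat_uminus[OF bilb] Let_def)
    have sharp0: "sharp g 0 = 0"
      using sharp_flat[OF g, of 0] linear_0[OF linear_flat[OF inner_product_bilinear[OF g]]] by simp
    show ?thesis
    proof
      assume "\<G> = b_conjugate b (block (\<lambda>_. 0) (sharp g) (flat g) (\<lambda>_. 0))"
      then have G: "\<G> (X, \<xi>) = (let Y = sharp g (\<xi> - flat b X) in (Y, flat g X + flat b Y))"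
        for X \<xi> using val by simp
      have g0: "flat g 0 = 0"
        using linear_0[OF linear_flat[OF inner_product_bilinear[OF g]]] .
      show ?swap by (simp add: G Let_def b0 g0 sharp0 sharp_flat[OF g])
    next
      assume swap: ?swap
      show "\<G> = b_conjugate b (block (\<lambda>_. 0) (sharp g) (flat g) (\<lambda>_. 0))"
      proof (rule ext, clarify)
        fix X \<xi>
        define Y where "Y = sharp g (\<xi> - flat b X)"
        have "(X, \<xi>) = (X, flat b X) + (0, flat g Y)"
          by (simp add: Y_def flat_sharp[OF g])
        then have "\<G> (X, \<xi>) = \<G> (X, flat b X) + \<G> (0, flat g Y)"
          using linear_add[OF assms] by metis
        also have "\<dots> = (Y, flat g X + flat b Y)"
          using swap by (simp add: add.commute)
        finally show "\<G> (X, \<xi>) = b_conjugate b (block (\<lambda>_. 0) (sharp g) (flat g) (\<lambda>_. 0)) (X, \<xi>)"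
          by (simp add: val Let_def Y_def)
      qed
    qed
  qed
  then show ?thesis unfolding gm_decomposition_def by blast
qed

lemma pairing_eq:
  "pairing x y = (1/2) * (blinfun_apply (snd x) (fst y) + blinfun_apply (snd y) (fst x))"
  by (cases x; cases y) simp

lemma bilinear_pairing: "bilinear pairing"
  by (auto simp: bilinear_def pairing_eq blinfun.bilinear_simps add_divide_distrib algebra_simps
      intro!: linearI)

lemma pairing_commute: "pairing x y = pairing y x"
  by (simp add: pairing_eq add.commute)

lemma generalized_metric_inner:
  assumes "generalized_metric \<G>"
  shows "is_inner_product (gm_inner \<G>)"
proof -
  have lin: "linear \<G>" and orth: "\<And>x y. pairing (\<G> x) (\<G> y) = pairing x y"
    and inv: "\<And>x. \<G> (\<G> x) = x" and pos: "\<And>x. x \<noteq> 0 \<Longrightarrow> pairing (\<G> x) x > 0"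
    using assms by (auto simp: generalized_metric_def fun_eq_iff)
  have "bilinear (gm_inner \<G>)"
    unfolding gm_inner_def bilinear_def
    by (intro conjI allI linearI)
      (simp_all add: linear_add[OF lin] linear_scale[OF lin] bilinear_ladd[OF bilinear_pairing]
        bilinear_radd[OF bilinear_pairing] bilinear_lmul[OF bilinear_pairing]
        bilinear_rmul[OF bilinear_pairing])
  moreover have "gm_inner \<G> x y = gm_inner \<G> y x" for x y
    using orth[of "\<G> x" y] by (simp add: gm_inner_def inv pairing_commute)
  ultimately show ?thesis
    using pos by (simp add: is_inner_product_def gm_inner_def)
qed

text \<open>
  Positivity makes the upper right block of \<open>\<G>\<close>, a map from the dual to the Lie algebra,
  injective and hence invertible. Its inverse is \<open>g\<close>, and \<open>b\<close> is read off from the image of the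
  dual under \<open>\<G>\<close>, which is the graph of \<open>b\<close>.
\<close>

lemma gm_decomposition_exists:
  fixes \<G> :: "'a::euclidean_space double \<Rightarrow> 'a double"
  assumes G: "generalized_metric \<G>"
  shows "\<exists>g b. gm_decomposition \<G> g b"
proof -
  have lin: "linear \<G>" and orth: "\<And>x y. pairing (\<G> x) (\<G> y) = pairing x y"
    and inv: "\<And>x. \<G> (\<G> x) = x" and pos: "\<And>x. x \<noteq> 0 \<Longrightarrow> pairing (\<G> x) x > 0"
    using G by (auto simp: generalized_metric_def fun_eq_iff)
  define F where "F \<xi> = fst (\<G> (0, \<xi>))" for \<xi>
  have G_lin: "\<G> (0, \<xi> + \<eta>) = \<G> (0, \<xi>) + \<G> (0, \<eta>)" "\<G> (0, c *\<^sub>R \<xi>) = c *\<^sub>R \<G> (0, \<xi>)"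
    for \<xi> \<eta> c
    using linear_add[OF lin, of "(0, \<xi>)" "(0, \<eta>)"] linear_scale[OF lin, of c "(0, \<xi>)"] by simp_all
  have linF: "linear F"
    by (rule linearI) (simp_all add: F_def G_lin)
  have F_pos: "blinfun_apply \<xi> (F \<xi>) > 0" if "\<xi> \<noteq> 0" for \<xi>
    using pos[of "(0, \<xi>)"] that by (simp add: pairing_eq F_def zero_prod_def)
  have F_inj: "\<xi> = \<eta>" if "F \<xi> = F \<eta>" for \<xi> \<eta>
  proof (rule ccontr)
    assume "\<xi> \<noteq> \<eta>"
    then have "blinfun_apply (\<xi> - \<eta>) (F (\<xi> - \<eta>)) > 0" by (intro F_pos) simp
    then show False using that by (simp add: linear_diff[OF linF] blinfun.bilinear_simps)
  qed
  let ?J = "flat (inner :: 'a \<Rightarrow> _)"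
  have J: "sharp inner (?J X) = X" for X by (rule sharp_flat[OF is_inner_product_inner])
  have linFJ: "linear (\<lambda>X. F (?J X))"
    using linear_compose[OF linear_flat[OF inner_product_bilinear[OF is_inner_product_inner]] linF]
    by (simp add: o_def)
  have "inj (\<lambda>X. F (?J X))"
    by (rule injI) (metis F_inj J)
  then have "surj (\<lambda>X. F (?J X))"
    using linFJ by (simp add: linear_injective_imp_surjective)
  then obtain k where k: "\<And>X. F (?J (k X)) = X"
    unfolding surj_def by metis
  define gf where "gf X = ?J (k X)" for X
  have F_gf: "F (gf X) = X" for X by (simp add: gf_def k)
  have gf_lin: "gf (X + Y) = gf X + gf Y" "gf (c *\<^sub>R X) = c *\<^sub>R gf X" for X Y c
    by (rule F_inj; simp add: linear_add[OF linF] linear_scale[OF linF] F_gf)+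
  define g where "g X Y = blinfun_apply (gf X) Y" for X Y
  define b where "b X Y = blinfun_apply (snd (\<G> (0, gf X))) Y" for X Y
  have bilg: "bilinear g" and bilb: "bilinear b"
    unfolding bilinear_def g_def b_def
    by (auto intro!: linearI simp: gf_lin G_lin blinfun.bilinear_simps)
  have flat_g: "flat g X = gf X" for X
    by (rule blinfun_eqI) (simp add: flat_apply[OF bilg] g_def)
  have flat_b: "flat b X = snd (\<G> (0, gf X))" for X
    by (rule blinfun_eqI) (simp add: flat_apply[OF bilb] b_def)
  have swap1: "\<G> (0, flat g X) = (X, flat b X)" for X
    using F_gf[of X] by (simp add: flat_g flat_b F_def prod_eq_iff)
  then have swap2: "\<G> (X, flat b X) = (0, flat g X)" for X
    using inv by metis
  have "gm_inner \<G> (0, flat g X) (0, flat g Y) = g Y X" for X Y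
    by (simp add: gm_inner_def swap1 pairing_eq flat_apply[OF bilg])
  then have "g X Y = g Y X" for X Y
    using generalized_metric_inner[OF G] unfolding is_inner_product_def by metis
  moreover have "g X X > 0" if "X \<noteq> 0" for X
  proof -
    have "gf X \<noteq> 0" using that F_gf[of X] linear_0[OF linF] by auto
    from F_pos[OF this] show ?thesis by (simp add: F_gf g_def)
  qed
  ultimately have "is_inner_product g" using bilg by (simp add: is_inner_product_def)
  moreover have "b X X = 0" for X
    using orth[of "(X, flat b X)" "(X, flat b X)"]
    by (simp add: swap2 pairing_eq flat_apply[OF bilb])
  then have "two_form b" using bilb by (simp add: two_form_def)
  ultimately show ?thesis
    using gm_decomposition_iff[OF lin] swap1 swap2 by blast
qed

lemma gm_decomposition_unique:
  fixes \<G> :: "'a::euclidean_space double \<Rightarrow> 'a double"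
  assumes lin: "linear \<G>" and 1: "gm_decomposition \<G> g b" and 2: "gm_decomposition \<G> g' b'"
  shows "g = g'" "b = b'"
proof -
  note D = gm_decomposition_iff[OF lin]
  have g: "is_inner_product g" "is_inner_product g'" using 1 2 by (simp_all add: D)
  have bil: "bilinear b" "bilinear b'" using 1 2 by (simp_all add: D two_form_def)
  have eq: "\<G> (0, flat g X) = (X, flat b X)" "\<G> (0, flat g' X) = (X, flat b' X)" for X
    using 1 2 by (simp_all add: D)
  have flat_g: "flat g X = flat g' X" for X
  proof -
    have "\<G> (0, flat g X) = (sharp g' (flat g X), flat b' (sharp g' (flat g X)))"
      using eq(2)[of "sharp g' (flat g X)"] by (simp add: flat_sharp g)
    then have "X = sharp g' (flat g X)" by (simp add: eq)
    then show ?thesis using flat_sharp[OF g(2)] by metis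
  qed
  then have flat_b: "flat b X = flat b' X" for X
    using eq(1)[of X] eq(2)[of X] by simp
  show "g = g'"
    using flat_g by (intro ext) (metis flat_apply g inner_product_bilinear)
  show "b = b'"
    using flat_b by (intro ext) (metis flat_apply bil)
qed

section \<open>The double\<close>

lemma three_form_d2:
  assumes \<mu>: "lie_bracket \<mu>" and b: "two_form b"
  shows "three_form (d2 \<mu> b)"
proof -
  have bil: "bilinear \<mu>" "bilinear b" and self: "\<And>x. \<mu> x x = 0" "\<And>x. b x x = 0"
    using \<mu> b by (simp_all add: lie_bracket_def two_form_def)
  note simps = bil[THEN bilinear_ladd] bil[THEN bilinear_radd] bil[THEN bilinear_lmul]
    bil[THEN bilinear_rmul] bil[THEN bilinear_lzero] bil[THEN bilinear_rzero]
  have b_skew: "b (\<mu> x y) z + b (\<mu> y x) z = 0" for x y z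
    unfolding bilinear_ladd[OF bil(2), symmetric]
    using alternating_skew[OF bil(1) self(1), of x y] by (simp add: simps)
  have "d2 \<mu> b x y x = - (b (\<mu> x y) x + b (\<mu> y x) x)" for x y
    by (simp add: d2_def self simps)
  then have "d2 \<mu> b x y x = 0" for x y
    by (simp only: b_skew minus_zero)
  then show ?thesis
    unfolding three_form_def
    by (auto simp: d2_def simps self algebra_simps intro!: linearI)
qed

lemma dorfman_eq:
  "dorfman \<mu> H x y = (\<mu> (fst x) (fst y), Blinfun (\<lambda>Z. - blinfun_apply (snd y) (\<mu> (fst x) Z)
     + blinfun_apply (snd x) (\<mu> (fst y) Z) + H (fst x) (fst y) Z))"
  by (cases x; cases y) simp

lemma fst_dorfman: "fst (dorfman \<mu> H x y) = \<mu> (fst x) (fst y)"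
  by (simp add: dorfman_eq)

lemma snd_dorfman_apply:
  assumes "bilinear \<mu>" "three_form H"
  shows "blinfun_apply (snd (dorfman \<mu> H x y)) Z =
    - blinfun_apply (snd y) (\<mu> (fst x) Z) + blinfun_apply (snd x) (\<mu> (fst y) Z)
    + H (fst x) (fst y) Z"
proof -
  have H3: "linear (H (fst x) (fst y))" using assms(2) by (simp add: three_form_def)
  have "linear (\<lambda>Z. - blinfun_apply (snd y) (\<mu> (fst x) Z) + blinfun_apply (snd x) (\<mu> (fst y) Z)
    + H (fst x) (fst y) Z)"
    by (rule linearI)
      (simp_all add: bilinear_radd[OF assms(1)] bilinear_rmul[OF assms(1)] linear_add[OF H3]
        linear_scale[OF H3] blinfun.bilinear_simps algebra_simps)
  then show ?thesis by (simp add: dorfman_eq blinfun_apply_Blinfun_linear)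
qed

lemma bilinear_dorfman:
  assumes \<mu>: "bilinear \<mu>" and H: "three_form H"
  shows "bilinear (dorfman \<mu> H)"
proof -
  have lin: "linear (\<lambda>x. H x y z)" "linear (\<lambda>y. H x y z)" for x y z
    using H by (simp_all add: three_form_def)
  show ?thesis
    unfolding bilinear_def
    by (intro conjI allI linearI prod_eqI blinfun_eqI)
      (simp_all add: fst_dorfman snd_dorfman_apply[OF assms] blinfun.bilinear_simps
        bilinear_ladd[OF \<mu>] bilinear_radd[OF \<mu>] bilinear_lmul[OF \<mu>] bilinear_rmul[OF \<mu>]
        linear_add[OF lin(1)] linear_add[OF lin(2)] linear_scale[OF lin(1)] linear_scale[OF lin(2)]
        algebra_simps)
qed

text \<open>
  The maps \<open>split\<close> and \<open>co_split\<close> are the isometric embeddings of \<open>(\<gg>, g)\<close> onto the graph of \<open>b\<close>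
  and onto the dual. They take the place of transporting everything to \<open>b = 0\<close> by \<open>e\<^sup>b\<close>.
\<close>

locale split_double =
  fixes \<mu> :: "'a::euclidean_space \<Rightarrow> 'a \<Rightarrow> 'a"
    and H :: "'a \<Rightarrow> 'a \<Rightarrow> 'a \<Rightarrow> real"
    and \<G> :: "'a double \<Rightarrow> 'a double"
    and g b :: "'a \<Rightarrow> 'a \<Rightarrow> real"
  assumes lie: "lie_bracket \<mu>"
    and H: "three_form H"
    and gen: "generalized_metric \<G>"
    and decomposition: "gm_decomposition \<G> g b"
begin

abbreviation "E \<equiv> orthonormal_basis g"
abbreviation "q \<equiv> gm_inner \<G>"
abbreviation "ad \<equiv> dorfman \<mu> H"

definition split where "split X = (X, flat b X)"
definition co_split where "co_split X = (0 :: 'a, flat g X)"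
definition torsion where "torsion X Y Z = H X Y Z + d2 \<mu> b X Y Z"

lemma linear_\<G>: "linear \<G>" and \<G>_involution: "\<G> (\<G> x) = x"
  using gen by (simp_all add: generalized_metric_def pointfree_idE)

lemma inner_g: "is_inner_product g" and two_form_b: "two_form b"
  and \<G>_split: "\<G> (split X) = co_split X" and \<G>_co_split: "\<G> (co_split X) = split X"
  using decomposition by (simp_all add: gm_decomposition_iff[OF linear_\<G>] split_def co_split_def)

lemma bilinear_\<mu>: "bilinear \<mu>" and bilinear_b: "bilinear b" and \<mu>_self: "\<mu> x x = 0"
  using lie two_form_b by (simp_all add: lie_bracket_def two_form_def)

sublocale base: metric_algebra g E \<mu>
  using orthonormal_basis_frame[OF inner_g]
  by (simp add: metric_algebra_def metric_algebra_axioms_def bilinear_\<mu> \<mu>_self)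

lemma gm_metric_eq: "gm_metric \<G> = g"
  unfolding gm_metric_def
  using decomposition gm_decomposition_unique[OF linear_\<G>] by (intro the_equality) blast+

lemma gm_two_form_eq: "gm_two_form \<G> = b"
  unfolding gm_two_form_def
  using decomposition gm_decomposition_unique[OF linear_\<G>] by (intro the_equality) blast+

lemma gm_torsion_eq: "gm_torsion \<mu> H \<G> = torsion"
  by (intro ext) (simp add: gm_torsion_def torsion_def gm_two_form_eq)

lemma three_form_torsion: "three_form torsion"
  using H three_form_d2[OF lie two_form_b] unfolding three_form_def torsion_def
  by (auto intro: linear_compose_add)

lemma inner_q: "is_inner_product q"
  by (rule generalized_metric_inner[OF gen])

lemma q_commute: "q x y = q y x"
  using inner_q unfolding is_inner_product_def by blast

lemma q_split: "q z (split X) = g (fst z) X"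
proof -
  have "q z (split X) = q (split X) z" by (rule q_commute)
  also have "\<dots> = g X (fst z)"
    by (simp add: gm_inner_def \<G>_split pairing_eq)
      (simp add: co_split_def flat_apply base.bilinear_q)
  finally show ?thesis by (simp add: base.q_commute)
qed

lemma q_co_split: "q z (co_split X) = blinfun_apply (snd z) X - b (fst z) X"
proof -
  have "q z (co_split X) = q (co_split X) z" by (rule q_commute)
  also have "\<dots> = blinfun_apply (snd z) X + b X (fst z)"
    by (simp add: gm_inner_def \<G>_co_split pairing_eq)
      (simp add: split_def flat_apply bilinear_b)
  finally show ?thesis using two_form_skew[OF two_form_b, of X "fst z"] by simp
qed

lemma fst_split [simp]: "fst (split X) = X" "fst (co_split X) = 0"
  by (simp_all add: split_def co_split_def)

lemma snd_split [simp]: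
  "blinfun_apply (snd (split X)) Y = b X Y" "blinfun_apply (snd (co_split X)) Y = g X Y"
  by (simp_all add: split_def co_split_def flat_apply bilinear_b base.bilinear_q)

lemma q_simps:
  "q (split X) (split Y) = g X Y" "q (co_split X) (split Y) = 0"
  "q (split X) (co_split Y) = 0" "q (co_split X) (co_split Y) = g X Y"
  by (simp_all add: q_split q_co_split base.q_simps bilinear_lzero[OF bilinear_b])

lemma linear_split: "linear split"
  unfolding split_def
  by (rule linearI) (simp_all add: linear_add[OF linear_flat[OF bilinear_b]]
      linear_scale[OF linear_flat[OF bilinear_b]])

lemma linear_co_split: "linear co_split"
  unfolding co_split_def
  by (rule linearI) (simp_all add: linear_add[OF linear_flat[OF base.bilinear_q]]
      linear_scale[OF linear_flat[OF base.bilinear_q]])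

lemma split_cases:
  obtains X Y where "z = split X + co_split Y"
proof
  show "z = split (fst z) + co_split (sharp g (snd z - flat b (fst z)))"
    by (simp add: split_def co_split_def flat_sharp[OF inner_g] prod_eq_iff)
qed

lemma split_inject: "split X = split Y \<longleftrightarrow> X = Y" "co_split X = co_split Y \<longleftrightarrow> X = Y"
proof -
  show "split X = split Y \<longleftrightarrow> X = Y" by (metis fst_split(1))
  show "co_split X = co_split Y \<longleftrightarrow> X = Y" by (metis base.q_eqI snd_split(2))
qed

lemma split_neq_co_split: "split e \<noteq> co_split f" if "e \<in> E"
proof
  assume eq: "split e = co_split f"
  have "q (split e) (split e) = q (co_split f) (split e)" by (simp only: eq)
  then show False using base.orthonormal[OF that that] by (simp add: q_simps)
qed

definition double_frame where "double_frame = split ` E \<union> co_split ` E"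

lemma sum_double_frame:
  "(\<Sum>a\<in>double_frame. F a) = (\<Sum>e\<in>E. F (split e)) + (\<Sum>e\<in>E. F (co_split e))"
proof -
  have "split ` E \<inter> co_split ` E = {}"
    using split_neq_co_split unfolding disjoint_iff image_iff by metis
  then show ?thesis
    unfolding double_frame_def
    by (simp add: sum.union_disjoint base.finite_frame sum.reindex inj_on_def split_inject)
qed

lemma double_metric_algebra: "metric_algebra q double_frame ad"
proof
  show "span double_frame = UNIV"
  proof (intro equalityI subset_UNIV subsetI)
    fix z
    obtain X Y where z: "z = split X + co_split Y" by (rule split_cases)
    have "split X \<in> span (split ` E)" "co_split Y \<in> span (co_split ` E)"
      by (simp_all add: linear_span_image linear_split linear_co_split base.span_frame)
    then show "z \<in> span double_frame"
      unfolding z double_frame_def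
      by (intro span_add) (auto intro: span_mono[THEN subsetD])
  qed
  show "q x y = (if x = y then 1 else 0)" if xy: "x \<in> double_frame" "y \<in> double_frame" for x y
    using xy split_neq_co_split unfolding double_frame_def
    by (auto simp: q_simps base.orthonormal split_inject)
  show "bilinear ad" by (rule bilinear_dorfman[OF bilinear_\<mu> H])
  show "ad x x = 0" for x
    using H by (intro prod_eqI blinfun_eqI)
      (simp_all add: fst_dorfman snd_dorfman_apply[OF bilinear_\<mu> H] \<mu>_self three_form_def)
qed (simp_all add: inner_q double_frame_def base.finite_frame)

sublocale double: metric_algebra q double_frame ad
  by (rule double_metric_algebra)

lemma zero_simps:
  "b 0 X = 0" "b X 0 = 0" "\<mu> 0 X = 0" "\<mu> X 0 = 0" "H 0 X Y = 0" "H X 0 Y = 0"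
proof -
  show "H 0 X Y = 0" "H X 0 Y = 0"
    using H linear_0 unfolding three_form_def by blast+
qed (simp_all add: bilinear_b bilinear_lzero bilinear_rzero base.bracket_simps)

text \<open>
  The torsion appears because transporting the bracket by \<open>e\<^sup>b\<close> replaces \<open>H\<close> by \<open>H + db\<close>. The
  zeros and the coadjoint terms are explained by total skew-symmetry: these are the values at
  \<open>(x, y, \<G> z)\<close> of the three-form \<open>2\<langle>\<mu>\<^sub>H(x, y), z\<rangle>\<close>, which vanishes as soon as two arguments lie in
  the dual.
\<close>

lemma structure_constants:
  "q (ad (split X) (split Y)) (split Z) = g (\<mu> X Y) Z"
  "q (ad (split X) (split Y)) (co_split Z) = torsion X Y Z"
  "q (ad (split X) (co_split Y)) (split Z) = 0"
  "q (ad (split X) (co_split Y)) (co_split Z) = - g (\<mu> X Z) Y"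
  "q (ad (co_split X) (split Y)) (split Z) = 0"
  "q (ad (co_split X) (split Y)) (co_split Z) = g (\<mu> Y Z) X"
  "q (ad (co_split X) (co_split Y)) z = 0"
proof -
  show "q (ad (split X) (split Y)) (co_split Z) = torsion X Y Z"
    using two_form_skew[OF two_form_b, of Y "\<mu> X Z"] two_form_skew[OF two_form_b, of X "\<mu> Y Z"]
    by (simp add: q_co_split fst_dorfman snd_dorfman_apply[OF bilinear_\<mu> H] torsion_def d2_def)
  have "ad (co_split X) (co_split Y) = 0"
    by (intro prod_eqI blinfun_eqI)
      (simp_all add: fst_dorfman snd_dorfman_apply[OF bilinear_\<mu> H] zero_simps base.q_simps)
  then show "q (ad (co_split X) (co_split Y)) z = 0"
    by (simp add: double.q_simps)
qed (simp_all add: q_split q_co_split fst_dorfman snd_dorfman_apply[OF bilinear_\<mu> H]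
    base.q_simps zero_simps base.q_commute[of _ "\<mu> _ _"])

text \<open>The operators \<open>ad\<close> of the double are skew for the pairing, hence traceless.\<close>

lemma double_unimodular: "endo_trace (ad x) = 0"
proof -
  have "endo_trace (ad x) = (\<Sum>a\<in>double_frame. q (ad x a) a)"
    by (rule double.endo_trace_frame[OF double.linear_bracket_right])
  also obtain X Y where "x = split X + co_split Y" by (rule split_cases)
  ultimately show ?thesis
    by (simp add: sum_double_frame double.bracket_simps double.q_simps structure_constants
        sum_negf)
qed

lemma double_ricci:
  "ricci_tensor ad q y z =
     (1/4) * (\<Sum>e\<in>double_frame. \<Sum>f\<in>double_frame. q (ad e f) y * q (ad e f) z)
     - (1/2) * (\<Sum>e\<in>double_frame. \<Sum>f\<in>double_frame. q (ad y e) f * q (ad z e) f)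
     - (1/2) * killing_form ad y z"
  using double.ricci_tensor_frame[of 0 y z]
  by (simp add: double_unimodular double.q_simps double.bracket_simps)

text \<open>The quadratic expressions in the structure constants that make up the curvature.\<close>

definition bracket_sq where
  "bracket_sq X Y = (\<Sum>e\<in>E. \<Sum>f\<in>E. g (\<mu> e f) X * g (\<mu> e f) Y)"
definition ad_sq where
  "ad_sq X Y = (\<Sum>e\<in>E. \<Sum>f\<in>E. g (\<mu> X e) f * g (\<mu> Y e) f)"
definition torsion_sq where
  "torsion_sq X Y = (\<Sum>e\<in>E. \<Sum>f\<in>E. torsion X e f * torsion Y e f)"
definition bracket_torsion where
  "bracket_torsion X Y = (\<Sum>e\<in>E. \<Sum>f\<in>E. g (\<mu> e f) X * torsion e f Y)"

lemma torsion_rotate: "torsion e f X = torsion X e f"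
  using three_form_skew[OF three_form_torsion] by (metis minus_minus)

lemma ad_sq_swap: "(\<Sum>e\<in>E. \<Sum>f\<in>E. g (\<mu> X f) e * g (\<mu> Y f) e) = ad_sq X Y"
  unfolding ad_sq_def by (rule sum.swap)

lemma ad_sq_left:
  "(\<Sum>e\<in>E. \<Sum>f\<in>E. g (\<mu> e X) f * g (\<mu> e Y) f) = ad_sq X Y"
  by (simp add: ad_sq_def base.bracket_skew[of _ X] base.bracket_skew[of _ Y] base.q_simps)

text \<open>
  The dual is an abelian ideal, so it lies in the kernel of the Killing form, while \<open>ad\<^sub>X\<close> acts on
  it by the coadjoint representation, which contributes the Killing form of \<open>\<gg>\<close> a second time.
\<close>

lemma double_killing:
  "killing_form ad (split X) (split Y) = 2 * killing_form \<mu> X Y"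
  "killing_form ad (split X) (co_split Y) = 0"
  "killing_form ad (co_split X) (split Y) = 0"
  "killing_form ad (co_split X) (co_split Y) = 0"
proof -
  have "(\<Sum>e\<in>E. \<Sum>f\<in>E. g (\<mu> X e) f * g (\<mu> Y f) e) = killing_form \<mu> X Y"
    unfolding base.killing_form_frame by (rule sum.swap)
  then show "killing_form ad (split X) (split Y) = 2 * killing_form \<mu> X Y"
    by (simp add: double.killing_form_frame sum_double_frame structure_constants sum.distrib)
      (simp add: base.killing_form_frame)
qed (simp_all add: double.killing_form_frame sum_double_frame structure_constants)

lemma double_ricci_blocks:
  "ricci_tensor ad q (split X) (split Y) =
     (1/4) * bracket_sq X Y - ad_sq X Y - (1/2) * torsion_sq X Y - killing_form \<mu> X Y"
  "ricci_tensor ad q (split X) (co_split Y) =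
     (1/4) * bracket_torsion X Y - (1/2) * bracket_torsion Y X"
  "ricci_tensor ad q (co_split X) (co_split Y) =
     (1/4) * torsion_sq X Y + (1/2) * ad_sq X Y - (1/2) * bracket_sq X Y"
proof -
  show "ricci_tensor ad q (split X) (split Y) =
     (1/4) * bracket_sq X Y - ad_sq X Y - (1/2) * torsion_sq X Y - killing_form \<mu> X Y"
    by (simp add: double_ricci double_killing sum_double_frame structure_constants sum.distrib
        ad_sq_swap field_simps flip: bracket_sq_def ad_sq_def torsion_sq_def)
  show "ricci_tensor ad q (split X) (co_split Y) =
     (1/4) * bracket_torsion X Y - (1/2) * bracket_torsion Y X"
    by (simp add: double_ricci double_killing sum_double_frame structure_constants sum.distrib
        bracket_torsion_def torsion_rotate mult.commute)
  show "ricci_tensor ad q (co_split X) (co_split Y) =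
     (1/4) * torsion_sq X Y + (1/2) * ad_sq X Y - (1/2) * bracket_sq X Y"
    using ad_sq_left[of X Y] sum.swap[of "\<lambda>e f. g (\<mu> e X) f * g (\<mu> e Y) f" E E]
    by (simp add: double_ricci double_killing sum_double_frame structure_constants sum.distrib
        torsion_rotate[of _ _ X] torsion_rotate[of _ _ Y] flip: bracket_sq_def torsion_sq_def)
qed

lemma sym_endosD:
  assumes "A \<in> sym_endos q"
  shows "linear A" "q (A x) y = q x (A y)"
  using assms unfolding sym_endos_def by blast+

section \<open>The projection onto the skew symmetric endomorphisms\<close>

lemma \<G>_symmetric: "q (\<G> x) y = q x (\<G> y)"
  using gen unfolding gm_inner_def \<G>_involution generalized_metric_def by metis

text \<open>
  Since \<open>2\<langle>x, y\<rangle> = q (\<G> x) y\<close>, moving \<open>C\<close> across \<open>q\<close> turns skewness for the pairing into a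
  commutation relation with \<open>\<G>\<close>.
\<close>

lemma symmetric_skew_iff:
  "C \<in> skew_endos pairing \<inter> sym_endos q \<longleftrightarrow>
    C \<in> sym_endos q \<and> (\<forall>x. \<G> (C x) = - C (\<G> x))"
proof -
  have pairing_q: "pairing x y = (1/2) * q (\<G> x) y" for x y
    by (simp add: gm_inner_def \<G>_involution)
  have key: "pairing (C x) y + pairing x (C y) = (1/2) * q (\<G> (C x) + C (\<G> x)) y"
    if "C \<in> sym_endos q" for x y
    using sym_endosD(2)[OF that, of "\<G> x" y] by (simp add: pairing_q double.q_simps)
  have "(\<forall>x y. q (\<G> (C x) + C (\<G> x)) y = 0) \<longleftrightarrow> (\<forall>x. \<G> (C x) = - C (\<G> x))"
    using double.q_eqI[of _ 0] double.q_simps by (metis add_eq_0_iff2)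
  then have "C \<in> skew_endos pairing \<longleftrightarrow> (\<forall>x. \<G> (C x) = - C (\<G> x))" if "C \<in> sym_endos q"
    by (simp add: skew_endos_def key[OF that] sym_endosD(1)[OF that] del: split_paired_All)
  then show ?thesis by blast
qed

lemma endo_trace_anticommuting:
  assumes K: "linear K" "\<And>x. K (\<G> x) = \<G> (K x)"
    and C: "linear C" "\<And>x. \<G> (C x) = - C (\<G> x)"
  shows "endo_trace (\<lambda>x. K (C x)) = 0"
proof -
  have comp: "linear (\<lambda>x. f (h x))"
    if "linear f" "linear h" for f h :: "'a double \<Rightarrow> 'a double"
    using linear_compose[OF that(2,1)] by (simp add: o_def)
  have "endo_trace (\<lambda>x. K (C x)) = endo_trace (\<lambda>x. K (\<G> (\<G> (C x))))"
    by (simp add: \<G>_involution)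
  also have "\<dots> = endo_trace (\<lambda>x. \<G> (C (K (\<G> x))))"
    using double.endo_trace_compose_commute[OF comp[OF K(1) linear_\<G>] comp[OF linear_\<G> C(1)]] .
  also have "\<dots> = endo_trace (\<lambda>x. - C (K x))"
    by (simp add: C(2) K(2) \<G>_involution)
  also have "\<dots> = - endo_trace (\<lambda>x. C (K x))"
    by (simp add: double.endo_trace_frame comp[OF C(1) K(1)] linear_compose_neg[OF comp[OF C(1) K(1)]]
        double.q_simps sum_negf)
  also have "endo_trace (\<lambda>x. C (K x)) = endo_trace (\<lambda>x. K (C x))"
    by (rule double.endo_trace_compose_commute[OF C(1) K(1)])
  finally show ?thesis by simp
qed

text \<open>
  The projection is the part that anticommutes with \<open>\<G>\<close>: the complementary part commutes with
  \<open>\<G>\<close>, and conjugation by \<open>\<G>\<close> shows that the two are trace-orthogonal. It is unique because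
  \<open>tr (A B)\<close> is positive definite on symmetric endomorphisms.
\<close>

lemma so_projection_eq:
  assumes A: "A \<in> sym_endos q"
  shows "so_projection \<G> A = (\<lambda>x. (1/2) *\<^sub>R (A x - \<G> (A (\<G> x))))" (is "_ = ?P")
proof -
  let ?S = "skew_endos pairing \<inter> sym_endos q"
  note \<G>_lin = linear_add[OF linear_\<G>] linear_diff[OF linear_\<G>] linear_scale[OF linear_\<G>]
    linear_neg[OF linear_\<G>]
  have linA: "linear A" and symA: "\<And>x y. q (A x) y = q x (A y)"
    by (rule sym_endosD[OF A])+
  note A_lin = linear_add[OF linA] linear_diff[OF linA] linear_scale[OF linA]
  have "linear ?P"
    by (rule linearI) (simp_all add: A_lin \<G>_lin algebra_simps)
  moreover have "q (?P x) y = q x (?P y)" for x y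
    by (simp add: double.q_simps symA \<G>_symmetric)
  moreover have "\<G> (?P x) = - ?P (\<G> x)" for x
    by (simp add: \<G>_lin \<G>_involution flip: scaleR_minus_right)
  ultimately have P: "?P \<in> ?S"
    unfolding symmetric_skew_iff unfolding sym_endos_def by blast
  have orth: "endo_trace ((\<lambda>x. A x - ?P x) \<circ> C) = 0" if "C \<in> ?S" for C
  proof -
    have "linear C" "\<And>x. \<G> (C x) = - C (\<G> x)"
      using that unfolding symmetric_skew_iff by (blast dest: sym_endosD)+
    moreover have "linear (\<lambda>x. A x - ?P x)"
      by (rule linearI) (simp_all add: A_lin \<G>_lin algebra_simps)
    moreover have "A (\<G> x) - ?P (\<G> x) = \<G> (A x - ?P x)" for x
    proof -
      have half: "v - (1/2) *\<^sub>R (v - w) = (1/2) *\<^sub>R (v + w)" for v w :: "'a double"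
        by (simp add: algebra_simps flip: scaleR_add_left)
      show ?thesis
        unfolding half by (simp add: \<G>_lin \<G>_involution add.commute)
    qed
    ultimately show ?thesis
      using endo_trace_anticommuting[of "\<lambda>x. A x - ?P x" C] by (simp add: o_def)
  qed
  show ?thesis
    unfolding so_projection_def
  proof (rule the_equality)
    fix P' assume P': "P' \<in> ?S \<and> (\<forall>C\<in>?S. endo_trace ((\<lambda>x. A x - P' x) \<circ> C) = 0)"
    define D where "D x = ?P x - P' x" for x
    have lin: "linear ?P" "linear P'" and sym: "\<And>x y. q (P' x) y = q x (P' y)"
      and anti: "\<And>x. \<G> (P' x) = - P' (\<G> x)" "\<And>x. \<G> (?P x) = - ?P (\<G> x)"
      using P P' unfolding symmetric_skew_iff by (blast dest: sym_endosD)+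
    have linD: "linear D"
      unfolding D_def by (rule linear_compose_sub[OF lin])
    have symD: "q (D x) y = q x (D y)" for x y
      by (simp add: D_def double.q_simps symA \<G>_symmetric sym)
    have "\<G> (D x) = - D (\<G> x)" for x
      unfolding D_def linear_diff[OF linear_\<G>] anti by simp
    then have "D \<in> ?S"
      unfolding symmetric_skew_iff unfolding sym_endos_def using linD symD by blast
    then have tr: "endo_trace ((\<lambda>x. A x - ?P x) \<circ> D) = 0" "endo_trace ((\<lambda>x. A x - P' x) \<circ> D) = 0"
      using orth P' by blast+
    have lins: "linear ((\<lambda>x. A x - ?P x) \<circ> D)" "linear ((\<lambda>x. A x - P' x) \<circ> D)"
      by (intro linear_compose[OF linD] linear_compose_sub linA lin)+
    have "(\<Sum>a\<in>double_frame. q (D a) (D a))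
      = endo_trace ((\<lambda>x. A x - P' x) \<circ> D) - endo_trace ((\<lambda>x. A x - ?P x) \<circ> D)"
      unfolding double.endo_trace_frame[OF lins(1)] double.endo_trace_frame[OF lins(2)]
        sum_subtractf[symmetric]
    proof (rule sum.cong)
      fix a
      have "q (D a) (D a) = q (D (D a)) a" by (simp add: symD)
      also have "\<dots> = q ((A (D a) - P' (D a)) - (A (D a) - ?P (D a))) a"
        by (simp add: D_def)
      finally show "q (D a) (D a)
        = q (((\<lambda>x. A x - P' x) \<circ> D) a) a - q (((\<lambda>x. A x - ?P x) \<circ> D) a) a"
        by (simp only: double.q_simps o_apply)
    qed simp
    then have "(\<Sum>a\<in>double_frame. q (D a) (D a)) = 0" using tr by simp
    moreover have "q v v \<ge> 0" "q v v = 0 \<Longrightarrow> v = 0" for v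
      using double.q_positive[of v] by (cases "v = 0"; simp add: double.q_simps)+
    ultimately have "D a = 0" if "a \<in> double_frame" for a
      using that double.finite_frame by (simp add: sum_nonneg_eq_0_iff)
    then have "D x = 0" for x
      using double.linear_frame_expansion[OF linD, of x] by simp
    then show "P' = ?P" by (auto simp: D_def fun_eq_iff)
  qed (use P orth in blast)
qed

section \<open>Generalized curvature\<close>

definition U where "U = mean_curvature_vector \<mu> g"

lemma U: "g U X = endo_trace (\<mu> X)"
  unfolding U_def mean_curvature_vector_def
  by (simp add: sharp_works[OF inner_g] blinfun_apply_Blinfun_linear[OF base.linear_trace_ad])

lemma base_ricci:
  "ricci_tensor \<mu> g X Y = (1/4) * bracket_sq X Y - (1/2) * ad_sq X Y
     - (1/2) * killing_form \<mu> X Y - (1/2) * (g (\<mu> U X) Y + g (\<mu> U Y) X)"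
  by (simp add: base.ricci_tensor_frame[OF U] base.endo_trace_ad_bracket[OF lie]
      bracket_sq_def ad_sq_def)

lemma codifferential_torsion:
  "codiff3 \<mu> g torsion X Y
     = torsion U X Y - (1/2) * bracket_torsion X Y + (1/2) * bracket_torsion Y X"
  by (simp add: base.codiff3_frame[OF U three_form_torsion refl] bracket_torsion_def)

lemma form_square_torsion: "form_square g torsion = torsion_sq"
  by (intro ext) (simp add: form_square_def tensor2_inner_def torsion_sq_def)

lemma torsion_linear:
  "linear (\<lambda>X. torsion X Y Z)" "linear (\<lambda>Y. torsion X Y Z)" "linear (torsion X Y)"
  using three_form_torsion by (simp_all add: three_form_def)

lemmas torsion_simps =
  torsion_linear[THEN linear_add] torsion_linear[THEN linear_scale]

lemma bilinear_torsion_sq: "bilinear torsion_sq"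
  unfolding bilinear_def
  by (intro conjI allI linearI)
    (simp_all add: torsion_sq_def torsion_simps algebra_simps sum.distrib sum_distrib_left)

lemma bilinear_codifferential: "bilinear (codiff3 \<mu> g torsion)"
  unfolding bilinear_def
  by (intro conjI allI linearI)
    (simp_all add: codifferential_torsion bracket_torsion_def base.q_simps torsion_simps
      algebra_simps sum.distrib sum_distrib_left add_divide_distrib)

definition ricci_form where
  "ricci_form X Y = ricci_tensor \<mu> g X Y - (1/4) * form_square g torsion X Y"

lemma bilinear_ricci_form: "bilinear ricci_form"
proof -
  note bil = base.bilinear_ricci_tensor[OF U] bilinear_torsion_sq
  show ?thesis
    unfolding bilinear_def ricci_form_def form_square_torsion
    by (intro conjI allI linearI)
      (simp_all add: bil[THEN bilinear_ladd] bil[THEN bilinear_radd] bil[THEN bilinear_lmul]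
        bil[THEN bilinear_rmul] algebra_simps add_divide_distrib)
qed

lemma ricci_form_commute: "ricci_form X Y = ricci_form Y X"
  using base.ricci_tensor_commute[OF U base.endo_trace_ad_bracket[OF lie], of X Y]
  by (simp add: ricci_form_def form_square_torsion torsion_sq_def mult.commute)

abbreviation "R \<equiv> operator_of g ricci_form"
abbreviation "\<delta> X \<equiv> sharp g (flat (codiff3 \<mu> g torsion) X)"

lemma R_works: "g (R X) Y = ricci_form X Y"
  by (rule base.operator_of_works[OF bilinear_ricci_form])

lemma \<delta>_works: "g (\<delta> X) Y = codiff3 \<mu> g torsion X Y"
  by (simp add: sharp_works[OF inner_g] flat_apply[OF bilinear_codifferential])

lemma gen_ricci_split:
  "gen_ricci \<mu> H \<G> (split X + co_split Y) =
     split (R X + (1/2) *\<^sub>R \<delta> Y) + co_split (- (1/2) *\<^sub>R \<delta> X - R Y)"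
proof -
  have dual: "Blinfun (\<lambda>W. g Y (R W)) = flat g (R Y)"
  proof -
    have "g Y (R W) = g (R Y) W" for W
      by (simp add: base.q_commute[of Y] R_works ricci_form_commute[of Y])
    then show ?thesis by (simp add: flat_def)
  qed
  have form: "(\<lambda>X Y. ricci_tensor \<mu> g X Y - form_square g torsion X Y / 4) = ricci_form"
    by (intro ext) (simp add: ricci_form_def)
  have flat_fn: "blinfun_apply (flat g Y) = g Y"
    by (intro ext) (simp add: flat_apply base.bilinear_q)
  note flat_lin = linear_flat[OF base.bilinear_q]
  have "co_split (- (1/2) *\<^sub>R \<delta> X - R Y)
      = (0, - (1/2) *\<^sub>R flat (codiff3 \<mu> g torsion) X - flat g (R Y))"
    by (simp add: co_split_def linear_diff[OF flat_lin] linear_neg[OF flat_lin]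
        linear_scale[OF flat_lin] flat_sharp[OF inner_g])
  moreover have "gen_ricci \<mu> H \<G> (split X + co_split Y) =
     split (R X + (1/2) *\<^sub>R \<delta> Y) + (0, - (1/2) *\<^sub>R flat (codiff3 \<mu> g torsion) X - flat g (R Y))"
    by (simp add: gen_ricci_def Let_def gm_metric_eq gm_two_form_eq gm_torsion_eq form
        b_conjugate_def split_def co_split_def flat_uminus[OF bilinear_b] sharp_flat[OF inner_g]
        flat_fn dual)
  ultimately show ?thesis by simp
qed

definition curv where
  "curv x = (2/3) *\<^sub>R ricci_operator ad q x - (1/6) *\<^sub>R killing_operator \<mu> H \<G> x
     - sym_part q (ad (split U)) x"

lemma double_bilinear_ricci: "bilinear (ricci_tensor ad q)"
  and double_ricci_commute: "ricci_tensor ad q x y = ricci_tensor ad q y x"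
  using double.bilinear_ricci_tensor[of 0] double.ricci_tensor_commute[of 0]
  by (auto simp: double_unimodular double.q_simps)

lemma ricci_operator_works: "q (ricci_operator ad q x) y = ricci_tensor ad q x y"
  unfolding ricci_operator_def by (rule double.operator_of_works[OF double_bilinear_ricci])

lemma killing_operator_works: "q (killing_operator \<mu> H \<G> x) y = killing_form ad x y"
  unfolding killing_operator_def by (rule double.operator_of_works[OF double.bilinear_killing_form])

lemma linear_operators: "linear (ricci_operator ad q)" "linear (killing_operator \<mu> H \<G>)"
  unfolding ricci_operator_def killing_operator_def
  by (intro double.linear_operator_of double_bilinear_ricci double.bilinear_killing_form)+

lemma q_curv:
  "q (curv x) y = (2/3) * ricci_tensor ad q x y - (1/6) * killing_form ad x y
     - (1/2) * (q (ad (split U) x) y + q (ad (split U) y) x)"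
  by (simp add: curv_def double.q_simps ricci_operator_works killing_operator_works
      double.sym_part_works[OF double.linear_bracket_right] q_commute[of x])

lemma curv_symmetric: "curv \<in> sym_endos q"
proof -
  have "linear curv"
    unfolding curv_def
    by (intro linear_compose_sub linear_compose_scale_right linear_operators double.linear_sym_part
        double.linear_bracket_right)
  moreover have "q (curv x) y = q x (curv y)" for x y
    unfolding q_commute[of x] q_curv
    using double_ricci_commute[of x y] double.killing_form_commute[of x y] by simp
  ultimately show ?thesis by (simp add: sym_endos_def)
qed

text \<open>
  Apart from the Killing form and the terms in \<open>U\<close>, the Ricci tensor of the double gives three
  halves of the right-hand sides, hence the factor \<open>2/3\<close>. After this scaling the Killing form of
  \<open>\<gg>\<close> appears with coefficient \<open>- 2/3\<close> on the diagonal, which \<open>- B/6\<close> completes to \<open>- 1\<close>. The terms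
  in \<open>U\<close>, in both formulas, come from \<open>ad\<^sub>U\<close>.
\<close>

lemma curv_blocks:
  "q (curv (split X)) (split Y) - q (curv (co_split X)) (co_split Y) = 2 * ricci_form X Y"
  "q (curv (split X)) (co_split Y) - q (curv (co_split X)) (split Y) = - codiff3 \<mu> g torsion X Y"
proof -
  show "q (curv (split X)) (split Y) - q (curv (co_split X)) (co_split Y) = 2 * ricci_form X Y"
    by (simp add: q_curv double_ricci_blocks double_killing structure_constants ricci_form_def
        form_square_torsion base_ricci field_simps)
  have "ricci_tensor ad q (co_split X) (split Y) = ricci_tensor ad q (split Y) (co_split X)"
    by (rule double_ricci_commute)
  moreover have "torsion U Y X = - torsion U X Y"
    by (rule three_form_skew(2)[OF three_form_torsion])
  ultimately show
    "q (curv (split X)) (co_split Y) - q (curv (co_split X)) (split Y) = - codiff3 \<mu> g torsion X Y"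
    by (simp add: q_curv double_ricci_blocks double_killing structure_constants
        codifferential_torsion field_simps)
qed

lemma gen_ricci_eq: "gen_ricci \<mu> H \<G> = so_projection \<G> curv"
proof
  fix z
  obtain X Y where z: "z = split X + co_split Y" by (rule split_cases)
  have lin: "linear curv" by (rule sym_endosD[OF curv_symmetric])
  show "gen_ricci \<mu> H \<G> z = so_projection \<G> curv z"
  proof (rule double.q_eqI)
    fix w
    obtain X' Y' where w: "w = split X' + co_split Y'" by (rule split_cases)
    have "q (so_projection \<G> curv z) w = (1/2) * (q (curv z) w - q (curv (\<G> z)) (\<G> w))"
      by (simp add: so_projection_eq[OF curv_symmetric] double.q_simps \<G>_symmetric)
    also have "\<dots> = (1/2) * (
        (q (curv (split X)) (split X') - q (curv (co_split X)) (co_split X'))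
        - (q (curv (split Y)) (split Y') - q (curv (co_split Y)) (co_split Y'))
        + (q (curv (split X)) (co_split Y') - q (curv (co_split X)) (split Y'))
        - (q (curv (split Y)) (co_split X') - q (curv (co_split Y)) (split X')))"
      unfolding z w
      by (simp add: linear_add[OF linear_\<G>] \<G>_split \<G>_co_split linear_add[OF lin] double.q_simps)
    also have "\<dots> = ricci_form X X' - ricci_form Y Y'
        - (1/2) * codiff3 \<mu> g torsion X Y' + (1/2) * codiff3 \<mu> g torsion Y X'"
      unfolding curv_blocks by simp
    also have "\<dots> = q (gen_ricci \<mu> H \<G> z) w"
      unfolding z w gen_ricci_split
      by (simp add: double.q_simps q_simps base.q_simps R_works \<delta>_works)
    finally show "q (gen_ricci \<mu> H \<G> z) w = q (so_projection \<G> curv z) w" by simp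
  qed
qed

lemma trace_bracket_sq: "(\<Sum>e\<in>E. bracket_sq e e) = (\<Sum>e\<in>E. ad_sq e e)"
proof -
  have "(\<Sum>x\<in>E. \<Sum>e\<in>E. \<Sum>f\<in>E. g (\<mu> e f) x * g (\<mu> e f) x)
      = (\<Sum>e\<in>E. \<Sum>x\<in>E. \<Sum>f\<in>E. g (\<mu> e f) x * g (\<mu> e f) x)"
    by (rule sum.swap)
  also have "\<dots> = (\<Sum>e\<in>E. \<Sum>f\<in>E. \<Sum>x\<in>E. g (\<mu> e f) x * g (\<mu> e f) x)"
    by (intro sum.cong refl sum.swap)
  finally show ?thesis by (simp add: bracket_sq_def ad_sq_def)
qed

lemma base_scalar_curvature:
  "scalar_curvature \<mu> g = - (1/4) * (\<Sum>e\<in>E. ad_sq e e) - (1/2) * (\<Sum>e\<in>E. killing_form \<mu> e e) - g U U"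
proof -
  note bil = base.bilinear_ricci_tensor[OF U]
  have "scalar_curvature \<mu> g = (\<Sum>e\<in>E. ricci_tensor \<mu> g e e)"
    by (simp add: scalar_curvature_def ricci_operator_def base.operator_of_works[OF bil]
        base.endo_trace_frame[OF base.linear_operator_of[OF bil]])
  also have "\<dots> = (1/4) * (\<Sum>e\<in>E. bracket_sq e e) - (1/2) * (\<Sum>e\<in>E. ad_sq e e)
      - (1/2) * (\<Sum>e\<in>E. killing_form \<mu> e e) - (\<Sum>e\<in>E. g (\<mu> U e) e)"
    by (simp add: base_ricci sum_subtractf sum.distrib sum_distrib_left sum_divide_distrib)
  also have "(\<Sum>e\<in>E. g (\<mu> U e) e) = g U U"
    by (simp add: U base.endo_trace_frame[OF base.linear_bracket_right])
  finally show ?thesis by (simp add: trace_bracket_sq)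
qed

lemma gen_scalar_eq:
  "gen_scalar \<mu> H \<G> = (1/2) * endo_trace (\<lambda>x.
     (2/3) *\<^sub>R ricci_operator ad q x - (1/6) *\<^sub>R killing_operator \<mu> H \<G> x) - g U U"
proof -
  have lin: "linear (\<lambda>x. (2/3) *\<^sub>R ricci_operator ad q x - (1/6) *\<^sub>R killing_operator \<mu> H \<G> x)"
    by (intro linear_compose_sub linear_compose_scale_right linear_operators)
  have "endo_trace (\<lambda>x. (2/3) *\<^sub>R ricci_operator ad q x - (1/6) *\<^sub>R killing_operator \<mu> H \<G> x)
    = (\<Sum>a\<in>double_frame. (2/3) * ricci_tensor ad q a a - (1/6) * killing_form ad a a)"
    by (simp add: double.endo_trace_frame[OF lin] double.q_simps ricci_operator_works
        killing_operator_works)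
  also have "\<dots> = - (1/2) * (\<Sum>e\<in>E. ad_sq e e) - (1/6) * (\<Sum>e\<in>E. torsion_sq e e)
      - (\<Sum>e\<in>E. killing_form \<mu> e e)"
    by (simp add: sum_double_frame double_ricci_blocks double_killing sum_subtractf sum.distrib
        trace_bracket_sq field_simps flip: sum_distrib_left sum_distrib_right sum_divide_distrib)
  finally have "endo_trace (\<lambda>x. (2/3) *\<^sub>R ricci_operator ad q x - (1/6) *\<^sub>R killing_operator \<mu> H \<G> x)
    = - (1/2) * (\<Sum>e\<in>E. ad_sq e e) - (1/6) * (\<Sum>e\<in>E. torsion_sq e e)
      - (\<Sum>e\<in>E. killing_form \<mu> e e)" .
  moreover have "tensor3_norm_sq g torsion = (\<Sum>e\<in>E. torsion_sq e e)"
    by (simp add: tensor3_norm_sq_def torsion_sq_def power2_eq_square)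
  ultimately show ?thesis
    by (simp add: gen_scalar_def gm_metric_eq gm_torsion_eq base_scalar_curvature)
qed

end

theorem theorem3p1:
  fixes \<mu> :: "'a::euclidean_space \<Rightarrow> 'a \<Rightarrow> 'a"
    and H :: "'a \<Rightarrow> 'a \<Rightarrow> 'a \<Rightarrow> real"
    and \<G> :: "'a double \<Rightarrow> 'a double"
  assumes "lie_bracket \<mu>"
    and "three_form H"
    and "\<And>X Y Z W. d3 \<mu> H X Y Z W = 0"
    and "generalized_metric \<G>"
  shows "(gen_ricci \<mu> H \<G> =
      so_projection \<G> (\<lambda>x.
        (2/3) *\<^sub>R ricci_operator (dorfman \<mu> H) (gm_inner \<G>) x
        - (1/6) *\<^sub>R killing_operator \<mu> H \<G> x
        - sym_part (gm_inner \<G>)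
            (dorfman \<mu> H (gm_splitting \<G> (mean_curvature_vector \<mu> (gm_metric \<G>)))) x)) \<and>
     (gen_scalar \<mu> H \<G> =
      (1/2) * endo_trace (\<lambda>x.
        (2/3) *\<^sub>R ricci_operator (dorfman \<mu> H) (gm_inner \<G>) x
        - (1/6) *\<^sub>R killing_operator \<mu> H \<G> x)
      - gm_metric \<G> (mean_curvature_vector \<mu> (gm_metric \<G>))
          (mean_curvature_vector \<mu> (gm_metric \<G>)))"
proof -
  obtain g b where "gm_decomposition \<G> g b"
    using gm_decomposition_exists[OF assms(4)] by blast
  then interpret split_double \<mu> H \<G> g b
    using assms by (simp add: split_double_def)
  have "gm_splitting \<G> (mean_curvature_vector \<mu> (gm_metric \<G>)) = split U"
    by (simp add: gm_splitting_def split_def U_def gm_metric_eq gm_two_form_eq)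
  then show ?thesis
    using gen_ricci_eq gen_scalar_eq unfolding curv_def U_def gm_metric_eq by simp
qed

end
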